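(* Assume $n>3t$ and a weak common coin with parameter $d\ge2$. Algorithm A1 (described in the context) solves binary Byzantine consensus: (Agreement) no two non-faulty processes decide different values; (Validity) every value decided by a non-faulty process was proposed by a non-faulty process, in particular if all non-faulty processes propose the same value $v$ then no value other than $v$ is decided; (Termination) with probability $1$ every non-faulty process decides, and the expected number of rounds until all non-faulty processes have decided is $O(1)$ (at most $d+1$ in expectation).
   Context: System model: $n$ asynchronous sequential processes $p_1,\dots,p_n$, of which at most $t$ are Byzantine (behave arbitrarily, may collude); the others are non-faulty. Processes communicate over reliable asynchronous point-to-point channels between every pair: messages between non-faulty processes are eventually delivered, unaltered, not duplicated, and the receiver knows the identity of the sender; there is no bound on delays and the adversary controls delivery order. "Broadcast $m$" means sending $m$ to every process (including oneself). When counting messages "received from $k$ distinct processes", at most one message per sender is counted. BV-Broadcast with tag $T$ and input $v$ at process $p_i$: set $\mathit{bin}_i\leftarrow\emptyset$; broadcast $\mathrm{BVAL}(T,v)$; return (a reference to) $\mathit{bin}_i$, which may keep growing afterwards. In the background, for every value $x$: when $\mathrm{BVAL}(T,x)$ has been received from $t+1$ distinct processes and $p_i$ has not yet broadcast $\mathrm{BVAL}(T,x)$, $p_i$ broadcasts $\mathrm{BVAL}(T,x)$; when $\mathrm{BVAL}(T,x)$ has been received from $2t+1$ distinct processes, $p_i$ adds $x$ to $\mathit{bin}_i$. SBV-Broadcast with tag $T$ and input $v$ at $p_i$: $\mathit{bin}_i\leftarrow$ BV-Broadcast with tag $T$ and input $v$; wait until $\mathit{bin}_i\neq\emptyset$;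 broadcast $\mathrm{AUX}(T,w)$ for some $w\in\mathit{bin}_i$; wait until there are $n-t$ distinct processes $p_j$ from which a message $\mathrm{AUX}(T,w_j)$ has been received with $w_j\in \mathit{bin}_i$ (the current value of the growing set); let $\mathit{view}_i$ be the set of these values $w_j$; return $(\mathit{view}_i,\mathit{bin}_i)$ ($\mathit{view}_i$ is fixed upon return, $\mathit{bin}_i$ may still grow). Weak common coin with parameter $d\ge 2$: for each round $r$, a call $\mathsf{random}()$ in round $r$ returns a bit to each non-faulty caller; with probability $1/d$ all non-faulty processes get $0$, with probability $1/d$ all get $1$, and with probability $(d-2)/d$ they may get different values. The round-$r$ output is random and unpredictable, and is not revealed to anyone before at least one non-faulty process has called $\mathsf{random}()$ in round $r$. Algorithm A1 (binary consensus), at non-faulty $p_i$ proposing $v_i\in\{0,1\}$: set $\mathit{est}\leftarrow v_i$, $r\leftarrow 0$. Repeat forever: (1) $r\leftarrow r+1$. (2) $(\mathit{view}_0,\mathit{bin})\leftarrow$ SBV-Broadcast with tag $(r,0)$ and input $\mathit{est}$. (3) Broadcast $\mathrm{AUXSET}(r,\mathit{view}_0)$. (4) Wait until there are $n-t$ distinct processes $p_j$ from which a message $\mathrm{AUXSET}(r,S_j)$ has been received with $S_j\subseteq\mathit{bin}$ (current value), and let $\mathit{view}_1=\bigcup_j S_j$. (5) If $\mathit{view}_1=\{w\}$ then $\mathit{est}\leftarrow w$, else $\mathit{est}\leftarrow\bot$. (6) $(\mathit{view}_2,\_)\leftarrow$ SBV-Broadcast with tag $(r,1)$ and input $\mathit{est}\in\{0,1,\bot\}$.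 (7) $s\leftarrow\mathsf{random}()$. (8) If $\mathit{view}_2=\{v\}$ with $v\neq\bot$: $\mathit{est}\leftarrow v$ and decide $v$ if not yet decided; if $\mathit{view}_2=\{v,\bot\}$ with $v\in\{0,1\}$: $\mathit{est}\leftarrow v$; if $\mathit{view}_2=\{\bot\}$: $\mathit{est}\leftarrow s$. *)

theory Defs
  imports "HOL-Probability.Probability"
begin

text \<open>
  Model of Algorithm A1 (binary Byzantine consensus with BV/SBV-broadcast and a
  weak common coin) as an asynchronous message-passing system driven by a
  full-information adversary.  Processes are 0..<n; F is the set of Byzantine
  processes.  Values 0/1/bottom are rendered as bool option (None = bottom).
  A tag (r,k) is a pair of naturals (k in {0,1}).
\<close>

type_synonym val = "bool option"
type_synonym tag = "nat \<times> nat"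

datatype msg = BVAL tag val | AUX tag val | AUXSET nat "val set"

text \<open>Control point of a non-faulty process inside its current round:
  WaitBin k: inside SBV-Broadcast with tag (r,k), waiting until bin is nonempty;
  WaitAux k: AUX sent, waiting for n-t suitable AUX messages;
  WaitAuxSet: step (4).\<close>
datatype phase = WaitBin nat | WaitAux nat | WaitAuxSet

record lstate =
  est :: val
  rnd :: nat
  pc :: phase
  dec :: "(bool \<times> nat) option"   \<comment> \<open>decided value together with the round of decision\<close>
  bvrecv :: "tag \<Rightarrow> val \<Rightarrow> nat set"
  bvsent :: "tag \<Rightarrow> val \<Rightarrow> bool"
  auxrecv :: "tag \<Rightarrow> nat \<Rightarrow> val option"
  auxsrecv :: "nat \<Rightarrow> nat \<Rightarrow> val set option"

text \<open>Weak common coin: per round, Agree b (all non-faulty get b) or Split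
  (non-faulty callers may get different values, chosen by the adversary).\<close>
datatype coin = CAgree bool | CSplit

record cfg =
  ls :: "nat \<Rightarrow> lstate"
  net :: "(nat \<times> nat \<times> msg) set"   \<comment> \<open>messages in transit: (sender, receiver, message)\<close>
  coins :: "nat \<Rightarrow> coin option"      \<comment> \<open>coin outputs revealed so far\<close>

text \<open>Adversary actions: deliver an in-transit message; deliver an arbitrary
  message from a Byzantine process; let a process perform its pending local step
  (choice of the AUX value; choice of the set of n-t (or more) processes whose
  messages form the view, and the coin bit used in case the coin is split).\<close>
datatype act = Deliver nat nat msg | Byz nat nat msg | AuxStep nat val
  | Ret nat "nat set" bool | Skip

definition correct :: "nat \<Rightarrow> nat set \<Rightarrow> nat set" where
  "correct n F = {0..<n} - F"

definition bin :: "nat \<Rightarrow> lstate \<Rightarrow> tag \<Rightarrow> val set" where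
  "bin t s T = {x. 2 * t + 1 \<le> card (bvrecv s T x)}"

definition bcast :: "nat \<Rightarrow> nat \<Rightarrow> msg \<Rightarrow> (nat \<times> nat \<times> msg) set" where
  "bcast n i m = {(i, j, m) | j. j < n}"

text \<open>Reception of a message by a non-faulty process i (including the BV-Broadcast
  background relay rule); returns the new local state and the messages sent.\<close>
fun recv :: "nat \<Rightarrow> nat \<Rightarrow> nat \<Rightarrow> nat \<Rightarrow> msg \<Rightarrow> lstate \<Rightarrow> lstate \<times> (nat \<times> nat \<times> msg) set" where
  "recv n t i src (BVAL T x) s =
     (let s' = s\<lparr>bvrecv := (bvrecv s)(T := (bvrecv s T)(x := insert src (bvrecv s T x)))\<rparr> in
      if t + 1 \<le> card (bvrecv s' T x) \<and> \<not> bvsent s' T x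
      then (s'\<lparr>bvsent := (bvsent s')(T := (bvsent s' T)(x := True))\<rparr>, bcast n i (BVAL T x))
      else (s', {}))"
| "recv n t i src (AUX T w) s =
     (if auxrecv s T src = None
      then (s\<lparr>auxrecv := (auxrecv s)(T := (auxrecv s T)(src := Some w))\<rparr>, {})
      else (s, {}))"
| "recv n t i src (AUXSET r S) s =
     (if auxsrecv s r src = None
      then (s\<lparr>auxsrecv := (auxsrecv s)(r := (auxsrecv s r)(src := Some S))\<rparr>, {})
      else (s, {}))"

definition qual :: "nat \<Rightarrow> nat \<Rightarrow> lstate \<Rightarrow> nat set \<Rightarrow> bool" where
  "qual n t s J = (J \<subseteq> {0..<n} \<and> n - t \<le> card J \<and>
     (case pc s of
        WaitAux k \<Rightarrow> (\<forall>j\<in>J. \<exists>w. auxrecv s (rnd s, k) j = Some w \<and> w \<in> bin t s (rnd s, k))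
      | WaitAuxSet \<Rightarrow> (\<forall>j\<in>J. \<exists>S. auxsrecv s (rnd s) j = Some S \<and> S \<subseteq> bin t s (rnd s, 0))
      | WaitBin k \<Rightarrow> False))"

definition auxok :: "nat \<Rightarrow> lstate \<Rightarrow> val \<Rightarrow> bool" where
  "auxok t s w = (case pc s of WaitBin k \<Rightarrow> w \<in> bin t s (rnd s, k) | _ \<Rightarrow> False)"

definition valid_local :: "nat \<Rightarrow> nat \<Rightarrow> nat set \<Rightarrow> nat \<Rightarrow> act \<Rightarrow> cfg \<Rightarrow> bool" where
  "valid_local n t F i a c = (i \<in> correct n F \<and>
     (case a of AuxStep j w \<Rightarrow> j = i \<and> auxok t (ls c i) w
              | Ret j J b \<Rightarrow> j = i \<and> qual n t (ls c i) J
              | _ \<Rightarrow> False))"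

definition local_enabled :: "nat \<Rightarrow> nat \<Rightarrow> nat set \<Rightarrow> nat \<Rightarrow> cfg \<Rightarrow> bool" where
  "local_enabled n t F i c = (\<exists>a. valid_local n t F i a c)"

definition step8 :: "val set \<Rightarrow> bool \<Rightarrow> lstate \<Rightarrow> lstate" where
  "step8 V s st =
     (if \<exists>v. V = {Some v} then
        (let v = the (the_elem V) in
         st\<lparr>est := Some v, dec := (if dec st = None then Some (v, rnd st) else dec st)\<rparr>)
      else if \<exists>v. V = {Some v, None} then st\<lparr>est := Some (THE v. V = {Some v, None})\<rparr>
      else if V = {None} then st\<lparr>est := Some s\<rparr>
      else st)"

definition step :: "nat \<Rightarrow> nat \<Rightarrow> nat set \<Rightarrow> (nat \<Rightarrow> coin) \<Rightarrow> act \<Rightarrow> cfg \<Rightarrow> cfg" where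
  "step n t F \<omega> a c =
    (case a of
       Deliver src dst m \<Rightarrow>
         (if (src, dst, m) \<in> net c then
            (if dst \<in> correct n F then
               (let (s', M) = recv n t dst src m (ls c dst) in
                c\<lparr>ls := (ls c)(dst := s'), net := (net c - {(src, dst, m)}) \<union> M\<rparr>)
             else c\<lparr>net := net c - {(src, dst, m)}\<rparr>)
          else c)
     | Byz src dst m \<Rightarrow>
         (if src \<in> F \<and> dst \<in> correct n F then
            (let (s', M) = recv n t dst src m (ls c dst) in
             c\<lparr>ls := (ls c)(dst := s'), net := net c \<union> M\<rparr>)
          else c)
     | AuxStep i w \<Rightarrow>
         (if valid_local n t F i a c then
            (let s = ls c i in
             case pc s of
               WaitBin k \<Rightarrow> c\<lparr>ls := (ls c)(i := s\<lparr>pc := WaitAux k\<rparr>),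
                              net := net c \<union> bcast n i (AUX (rnd s, k) w)\<rparr>
             | _ \<Rightarrow> c)
          else c)
     | Ret i J b \<Rightarrow>
         (if valid_local n t F i a c then
            (let s = ls c i; r = rnd s in
             case pc s of
               WaitAux 0 \<Rightarrow>
                 (let view0 = {w. \<exists>j\<in>J. auxrecv s (r, 0) j = Some w} in
                  c\<lparr>ls := (ls c)(i := s\<lparr>pc := WaitAuxSet\<rparr>),
                    net := net c \<union> bcast n i (AUXSET r view0)\<rparr>)
             | WaitAuxSet \<Rightarrow>
                 (let view1 = \<Union>{S. \<exists>j\<in>J. auxsrecv s r j = Some S};
                      e = (if \<exists>w. view1 = {w} then the_elem view1 else None) in
                  c\<lparr>ls := (ls c)(i := s\<lparr>est := e, pc := WaitBin 1,
                        bvsent := (bvsent s)((r, 1) := (bvsent s (r, 1))(e := True))\<rparr>),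
                    net := net c \<union> bcast n i (BVAL (r, 1) e)\<rparr>)
             | WaitAux (Suc 0) \<Rightarrow>
                 (let view2 = {w. \<exists>j\<in>J. auxrecv s (r, 1) j = Some w};
                      sc = (case \<omega> r of CAgree x \<Rightarrow> x | CSplit \<Rightarrow> b);
                      s8 = step8 view2 sc s;
                      s9 = s8\<lparr>rnd := r + 1, pc := WaitBin 0,
                        bvsent := (bvsent s8)((r + 1, 0) := (bvsent s8 (r + 1, 0))(est s8 := True))\<rparr> in
                  c\<lparr>ls := (ls c)(i := s9),
                    net := net c \<union> bcast n i (BVAL (r + 1, 0) (est s8)),
                    coins := (coins c)(r := Some (\<omega> r))\<rparr>)
             | _ \<Rightarrow> c)
          else c)
     | Skip \<Rightarrow> c)"

text \<open>Initial configuration: every non-faulty i has executed steps (1) and the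
  start of (2) of round 1: est = v_i and BVAL((1,0),v_i) broadcast.\<close>
definition init :: "nat \<Rightarrow> nat set \<Rightarrow> (nat \<Rightarrow> bool) \<Rightarrow> cfg" where
  "init n F inp =
    \<lparr> ls = (\<lambda>i. \<lparr> est = Some (inp i), rnd = 1, pc = WaitBin 0, dec = None,
                 bvrecv = (\<lambda>_ _. {}),
                 bvsent = (\<lambda>T x. T = (1, 0) \<and> x = Some (inp i)),
                 auxrecv = (\<lambda>_ _. None), auxsrecv = (\<lambda>_ _. None) \<rparr>),
      net = {(i, j, BVAL (1, 0) (Some (inp i))) | i j. i \<in> correct n F \<and> j < n},
      coins = (\<lambda>_. None) \<rparr>"

text \<open>An adversary maps the history (list of configurations, most recent first) to the
  next action.  The history contains only coin outputs already revealed, which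
  models unpredictability of the coin.\<close>
type_synonym adversary = "cfg list \<Rightarrow> act"

primrec run :: "nat \<Rightarrow> nat \<Rightarrow> nat set \<Rightarrow> (nat \<Rightarrow> bool) \<Rightarrow> adversary \<Rightarrow> (nat \<Rightarrow> coin) \<Rightarrow> nat \<Rightarrow> cfg list" where
  "run n t F inp \<sigma> \<omega> 0 = [init n F inp]"
| "run n t F inp \<sigma> \<omega> (Suc k) =
     step n t F \<omega> (\<sigma> (run n t F inp \<sigma> \<omega> k)) (hd (run n t F inp \<sigma> \<omega> k)) # run n t F inp \<sigma> \<omega> k"

definition exec :: "nat \<Rightarrow> nat \<Rightarrow> nat set \<Rightarrow> (nat \<Rightarrow> bool) \<Rightarrow> adversary \<Rightarrow> (nat \<Rightarrow> coin) \<Rightarrow> nat \<Rightarrow> cfg" where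
  "exec n t F inp \<sigma> \<omega> k = hd (run n t F inp \<sigma> \<omega> k)"

definition action :: "nat \<Rightarrow> nat \<Rightarrow> nat set \<Rightarrow> (nat \<Rightarrow> bool) \<Rightarrow> adversary \<Rightarrow> (nat \<Rightarrow> coin) \<Rightarrow> nat \<Rightarrow> act" where
  "action n t F inp \<sigma> \<omega> k = \<sigma> (run n t F inp \<sigma> \<omega> k)"

definition fair :: "nat \<Rightarrow> nat \<Rightarrow> nat set \<Rightarrow> (nat \<Rightarrow> bool) \<Rightarrow> adversary \<Rightarrow> (nat \<Rightarrow> coin) \<Rightarrow> bool" where
  "fair n t F inp \<sigma> \<omega> =
    ((\<forall>i\<in>correct n F. \<forall>j\<in>correct n F. \<forall>m k. (i, j, m) \<in> net (exec n t F inp \<sigma> \<omega> k) \<longrightarrow>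
        (\<exists>k'\<ge>k. action n t F inp \<sigma> \<omega> k' = Deliver i j m \<and> (i, j, m) \<in> net (exec n t F inp \<sigma> \<omega> k'))) \<and>
     (\<forall>i\<in>correct n F. \<forall>k. local_enabled n t F i (exec n t F inp \<sigma> \<omega> k) \<longrightarrow>
        (\<exists>k'\<ge>k. valid_local n t F i (action n t F inp \<sigma> \<omega> k') (exec n t F inp \<sigma> \<omega> k'))))"

definition admissible :: "nat \<Rightarrow> nat \<Rightarrow> nat set \<Rightarrow> (nat \<Rightarrow> bool) \<Rightarrow> adversary \<Rightarrow> bool" where
  "admissible n t F inp \<sigma> = (\<forall>\<omega>. fair n t F inp \<sigma> \<omega>)"

text \<open>Weak common coin with parameter d: Agree 0 w.p. 1/d, Agree 1 w.p. 1/d, Split w.p. (d-2)/d;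
  independent across rounds.\<close>
definition coin_pmf :: "real \<Rightarrow> coin pmf" where
  "coin_pmf d = bind_pmf (bernoulli_pmf (2 / d))
     (\<lambda>b. if b then map_pmf CAgree (bernoulli_pmf (1 / 2)) else return_pmf CSplit)"

definition coin_space :: "real \<Rightarrow> (nat \<Rightarrow> coin) measure" where
  "coin_space d = PiM UNIV (\<lambda>_. measure_pmf (coin_pmf d))"

text \<open>Number of rounds until all non-faulty processes have decided
  (the largest decision round; infinity if some never decides).\<close>
definition rounds :: "nat \<Rightarrow> nat \<Rightarrow> nat set \<Rightarrow> (nat \<Rightarrow> bool) \<Rightarrow> adversary \<Rightarrow> (nat \<Rightarrow> coin) \<Rightarrow> ennreal" where
  "rounds n t F inp \<sigma> \<omega> =
     Inf {of_nat r | r. \<exists>k. \<forall>i\<in>correct n F. \<exists>v r'.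
            dec (ls (exec n t F inp \<sigma> \<omega> k) i) = Some (v, r') \<and> r' \<le> r}"

end

theory Submission
  imports Defs
begin

text \<open>
  Safety rests on quorum intersection: two sets of \<open>n - t\<close> senders share a non-faulty process, and
  non-faulty processes send at most one AUX message per tag and one AUXSET message per round.  Hence
  two views of the same SBV-Broadcast intersect, at most one bit is ever an input of the second
  SBV-Broadcast of a round, and no round introduces an estimate that was not already an estimate at
  its beginning.

  Termination rests on the observation that when the coin of round \<open>r\<close> is first revealed, the only
  bit \<open>b\<close> that can still survive as the input of the second SBV-Broadcast of round \<open>r\<close> is determined:
  any quorum yielding \<open>b\<close> in step (4) shares a non-faulty process with the quorum of the process
  that revealed the coin, and that process had by then sent AUXSET with the singleton \<open>{b}\<close>.  So \<open>b\<close>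
  depends on the coins of earlier rounds only, and with probability at least \<open>1 / d\<close> the coin hits
  it, in which case all estimates agree after round \<open>r\<close> and everybody decides by round \<open>r + 1\<close>.  The
  round of the first hit is dominated by a geometric variable of mean \<open>d\<close>.
\<close>

section \<open>Local transitions\<close>

text \<open>The obstacle is the order of choices: the adversary sees the coin of round
  \<open>r\<close> as soon as one process has called it, while slow processes still have step (5) of
  that round ahead of them. What keeps the adversary from then steering the surviving bit away from
  the coin is the AUXSET exchange. Independence is argued on prefixes of runs: two coin sequences
  that agree below \<open>r\<close> produce the same run as long as coin \<open>r\<close> is hidden,
  and \<open>favoured r\<close> looks at such configurations only. Probability enters at the very
  end. Safety, and the fact that a hit leads to decisions, are shown for each fixed coin sequence;
  this is possible because \<open>admissible\<close> asks for fairness under every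
  \<open>\<omega>\<close>.\<close>

text \<open>A process passes five control points per round; \<open>stage\<close> numbers them consecutively, so that
  every local step increases it by exactly one.\<close>


definition stage :: "lstate \<Rightarrow> nat" where
  "stage s = 5 * rnd s + (case pc s of WaitBin q \<Rightarrow> 3 * q | WaitAux q \<Rightarrow> 3 * q + 1 | WaitAuxSet \<Rightarrow> 2)"

text \<open>The estimate is overwritten only in step (5), so at \<open>WaitAuxSet\<close> it is
  still the input of the first SBV-Broadcast.\<close>

definition tag_of :: "lstate \<Rightarrow> tag" where
  "tag_of s = (rnd s, case pc s of WaitBin q \<Rightarrow> q | WaitAux q \<Rightarrow> q | WaitAuxSet \<Rightarrow> 0)"

definition view_of :: "lstate \<Rightarrow> tag \<Rightarrow> nat set \<Rightarrow> val set" where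
  "view_of s T J = {v. \<exists>j\<in>J. auxrecv s T j = Some v}"

definition auxset_union :: "lstate \<Rightarrow> nat \<Rightarrow> nat set \<Rightarrow> val set" where
  "auxset_union s r J = \<Union>{S. \<exists>j\<in>J. auxsrecv s r j = Some S}"

definition singleton_value :: "val set \<Rightarrow> val" where
  "singleton_value U = (if \<exists>v. U = {v} then the_elem U else None)"

definition add_bval :: "nat \<Rightarrow> tag \<Rightarrow> val \<Rightarrow> lstate \<Rightarrow> lstate" where
  "add_bval src T x s = s\<lparr>bvrecv := (bvrecv s)(T := (bvrecv s T)(x := insert src (bvrecv s T x)))\<rparr>"

definition mark_bval :: "tag \<Rightarrow> val \<Rightarrow> lstate \<Rightarrow> lstate" where
  "mark_bval T x s = s\<lparr>bvsent := (bvsent s)(T := (bvsent s T)(x := True))\<rparr>"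

lemma add_bval_simps [simp]:
  "est (add_bval src T x s) = est s" "rnd (add_bval src T x s) = rnd s" "pc (add_bval src T x s) = pc s"
  "dec (add_bval src T x s) = dec s" "bvsent (add_bval src T x s) = bvsent s"
  "auxrecv (add_bval src T x s) = auxrecv s" "auxsrecv (add_bval src T x s) = auxsrecv s"
  "bvrecv (add_bval src T x s) T' y = (if T' = T \<and> y = x then insert src (bvrecv s T x) else bvrecv s T' y)"
  by (auto simp: add_bval_def)

lemma mark_bval_simps [simp]:
  "est (mark_bval T x s) = est s" "rnd (mark_bval T x s) = rnd s" "pc (mark_bval T x s) = pc s"
  "dec (mark_bval T x s) = dec s" "bvrecv (mark_bval T x s) = bvrecv s"
  "auxrecv (mark_bval T x s) = auxrecv s" "auxsrecv (mark_bval T x s) = auxsrecv s"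
  "bvsent (mark_bval T x s) T' y = (T' = T \<and> y = x \<or> bvsent s T' y)"
  by (auto simp: mark_bval_def)

lemma step8_simps [simp]:
  "rnd (step8 V b s) = rnd s" "pc (step8 V b s) = pc s" "bvrecv (step8 V b s) = bvrecv s"
  "bvsent (step8 V b s) = bvsent s" "auxrecv (step8 V b s) = auxrecv s" "auxsrecv (step8 V b s) = auxsrecv s"
  by (auto simp: step8_def Let_def)

text \<open>Adversary and history are abstracted away; what remains is one coin sequence with the
  configurations and actions it led to. Fairness joins only in the extension
  \<open>fair_execution\<close>.\<close>

locale execution =
  fixes n t :: nat and F :: "nat set" and inp :: "nat \<Rightarrow> bool" and w :: "nat \<Rightarrow> coin"
    and c :: "nat \<Rightarrow> cfg" and a :: "nat \<Rightarrow> act"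
  assumes resilience: "3 * t < n" and F_subset: "F \<subseteq> {0..<n}" and card_F: "card F \<le> t"
    and c_0: "c 0 = init n F inp" and c_Suc: "c (Suc k) = step n t F w (a k) (c k)"
begin

abbreviation "C \<equiv> correct n F"
abbreviation "L k i \<equiv> ls (c k) i"

lemma finite_F [simp]: "finite F"
  using F_subset finite_subset by blast

lemma C_less: "i \<in> C \<Longrightarrow> i < n"
  by (simp add: correct_def)

lemma finite_C [simp]: "finite C"
  by (simp add: correct_def)

lemma card_C: "n - t \<le> card C"
  using card_F F_subset by (simp add: correct_def card_Diff_subset)

lemma correct_in_large:
  assumes "t < card J" "J \<subseteq> {0..<n}"
  obtains j where "j \<in> J" "j \<in> C"
proof -
  have "\<not> J \<subseteq> F"
    using assms card_F card_mono[OF finite_F, of J] by linarith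
  then obtain j where "j \<in> J" "j \<notin> F" by blast
  with assms(2) that[of j] show thesis by (auto simp: correct_def)
qed

text \<open>Two quorums share at least \<open>n - 2 * t\<close> processes, which is more than
  \<open>t\<close> since \<open>3 * t < n\<close>, so not all of them are Byzantine.\<close>

lemma quorum_inter:
  assumes "J \<subseteq> {0..<n}" "n - t \<le> card J" "J' \<subseteq> {0..<n}" "n - t \<le> card J'"
  obtains j where "j \<in> J" "j \<in> J'" "j \<in> C"
proof -
  have fin: "finite J" "finite J'"
    using assms finite_subset by auto
  have "card (J \<union> J') \<le> n"
    using card_mono[of "{0..<n}" "J \<union> J'"] assms by auto
  then have "t < card (J \<inter> J')"
    using card_Un_Int[OF fin] assms resilience by linarith
  then show thesis
    using correct_in_large[of "J \<inter> J'"] assms that by (metis IntE inf.coboundedI1)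
qed

text \<open>Over-approximates a global step as seen by the non-faulty process \<open>i\<close>; the set of messages is
  what \<open>i\<close> broadcasts in it.  A relay may be repeated, which is harmless because \<open>bvrecv\<close> is a set.\<close>

inductive move :: "nat \<Rightarrow> nat \<Rightarrow> lstate \<Rightarrow> msg set \<Rightarrow> lstate \<Rightarrow> bool" for k i where
  idle: "move k i s {} s"
| bval: "src \<in> F \<or> (src, i, BVAL T x) \<in> net (c k) \<Longrightarrow>
    bvsent s T x \<or> card (insert src (bvrecv s T x)) \<le> t \<Longrightarrow> move k i s {} (add_bval src T x s)"
| relay: "src \<in> F \<or> (src, i, BVAL T x) \<in> net (c k) \<Longrightarrow> t + 1 \<le> card (insert src (bvrecv s T x)) \<Longrightarrow>
    move k i s {BVAL T x} (mark_bval T x (add_bval src T x s))"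
| aux: "src \<in> F \<or> (src, i, AUX T v) \<in> net (c k) \<Longrightarrow> auxrecv s T src = None \<Longrightarrow>
    move k i s {} (s\<lparr>auxrecv := (auxrecv s)(T := (auxrecv s T)(src := Some v))\<rparr>)"
| auxset: "src \<in> F \<or> (src, i, AUXSET r S) \<in> net (c k) \<Longrightarrow> auxsrecv s r src = None \<Longrightarrow>
    move k i s {} (s\<lparr>auxsrecv := (auxsrecv s)(r := (auxsrecv s r)(src := Some S))\<rparr>)"
| choose: "pc s = WaitBin q \<Longrightarrow> v \<in> bin t s (rnd s, q) \<Longrightarrow>
    move k i s {AUX (rnd s, q) v} (s\<lparr>pc := WaitAux q\<rparr>)"
| ret0: "pc s = WaitAux 0 \<Longrightarrow> qual n t s J \<Longrightarrow>
    move k i s {AUXSET (rnd s) (view_of s (rnd s, 0) J)} (s\<lparr>pc := WaitAuxSet\<rparr>)"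
| ret1: "pc s = WaitAuxSet \<Longrightarrow> qual n t s J \<Longrightarrow> e = singleton_value (auxset_union s (rnd s) J) \<Longrightarrow>
    move k i s {BVAL (rnd s, 1) e} (mark_bval (rnd s, 1) e (s\<lparr>est := e, pc := WaitBin 1\<rparr>))"
| ret2: "pc s = WaitAux 1 \<Longrightarrow> qual n t s J \<Longrightarrow> s' = step8 (view_of s (rnd s, 1) J) b s \<Longrightarrow>
    (\<forall>y. w (rnd s) = CAgree y \<longrightarrow> b = y) \<Longrightarrow>
    move k i s {BVAL (rnd s + 1, 0) (est s')}
      (mark_bval (rnd s + 1, 0) (est s') (s'\<lparr>rnd := rnd s + 1, pc := WaitBin 0\<rparr>))"

text \<open>Byzantine messages bypass \<open>net\<close>: \<open>Byz\<close> applies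
  \<open>recv\<close> directly, and only the relays of the correct receiver are put in transit.
  Hence the sender field of a message in transit can be trusted.\<close>

lemma net_correct: "(i, j, m) \<in> net (c k) \<Longrightarrow> i \<in> C \<and> j < n"
proof (induction k arbitrary: i j m)
  case 0
  then show ?case by (auto simp: c_0 init_def)
next
  case (Suc k)
  have recv: "(i, j, m) \<in> snd (recv n t dst src m' s) \<Longrightarrow> i = dst \<and> j < n" for dst src m' s
    by (cases m') (auto simp: bcast_def Let_def split: if_splits)
  show ?case
    using Suc.prems Suc.IH recv
    by (auto simp: c_Suc step_def bcast_def valid_local_def Let_def
        split: act.splits if_splits prod.splits phase.splits nat.splits) (metis snd_conv)+
qed

lemma recv_move:
  assumes "src \<in> F \<or> (src, i, m) \<in> net (c k)"
  shows "\<exists>Ms. move k i s Ms (fst (recv n t i src m s)) \<and> snd (recv n t i src m s) = (\<Union>m\<in>Ms. bcast n i m)"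
proof (cases m)
  case (BVAL T x)
  show ?thesis
  proof (cases "t + 1 \<le> card (insert src (bvrecv s T x)) \<and> \<not> bvsent s T x")
    case True
    then show ?thesis
      using move.relay[of src i T x k s] assms
      by (intro exI[of _ "{BVAL T x}"]) (simp add: BVAL Let_def add_bval_def mark_bval_def)
  next
    case False
    then show ?thesis
      using move.bval[of src i T x k s] assms
      by (intro exI[of _ "{}"]) (auto simp: BVAL Let_def add_bval_def)
  qed
next
  case (AUX T v)
  show ?thesis
    using move.aux[of src i T v k s] move.idle[of k i s] assms
    by (intro exI[of _ "{}"]) (simp add: AUX)
next
  case (AUXSET r S)
  show ?thesis
    using move.auxset[of src i r S k s] move.idle[of k i s] assms
    by (intro exI[of _ "{}"]) (simp add: AUXSET)
qed

lemma local_move: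
  assumes "i \<in> C" "valid_local n t F i (a k) (c k)"
  shows "\<exists>Ms. move k i (L k i) Ms (L (Suc k) i) \<and> net (c (Suc k)) = net (c k) \<union> (\<Union>m\<in>Ms. bcast n i m)"
proof (cases "a k")
  case (AuxStep j v)
  with assms obtain q where q: "pc (L k i) = WaitBin q" "v \<in> bin t (L k i) (rnd (L k i), q)" "j = i"
    by (auto simp: valid_local_def auxok_def split: phase.splits)
  show ?thesis
    using q AuxStep assms move.choose[OF q(1,2), of k i]
    by (intro exI[of _ "{AUX (rnd (L k i), q) v}"]) (simp add: c_Suc step_def Let_def)
next
  case (Ret j J b)
  with assms have j: "j = i" and qual: "qual n t (L k i) J"
    by (auto simp: valid_local_def)
  consider "pc (L k i) = WaitAux 0" | "pc (L k i) = WaitAux 1" | "pc (L k i) = WaitAuxSet" |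
    q where "pc (L k i) = WaitAux (Suc (Suc q))"
    using qual by (cases "pc (L k i)") (auto simp: qual_def, metis One_nat_def not0_implies_Suc)
  then show ?thesis
  proof cases
    case 1
    show ?thesis
      using 1 j Ret assms move.ret0[OF 1 qual, of k i]
      by (intro exI[of _ "{AUXSET (rnd (L k i)) (view_of (L k i) (rnd (L k i), 0) J)}"])
         (simp add: c_Suc step_def Let_def view_of_def)
  next
    case 2
    define b' where "b' = (case w (rnd (L k i)) of CAgree x \<Rightarrow> x | CSplit \<Rightarrow> b)"
    define s' where "s' = step8 (view_of (L k i) (rnd (L k i), 1) J) b' (L k i)"
    have "\<forall>y. w (rnd (L k i)) = CAgree y \<longrightarrow> b' = y"
      by (auto simp: b'_def)
    from move.ret2[OF 2 qual s'_def this, of k i]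
    have mv: "move k i (L k i) {BVAL (rnd (L k i) + 1, 0) (est s')}
      (mark_bval (rnd (L k i) + 1, 0) (est s') (s'\<lparr>rnd := rnd (L k i) + 1, pc := WaitBin 0\<rparr>))" .
    have "L (Suc k) i = mark_bval (rnd (L k i) + 1, 0) (est s') (s'\<lparr>rnd := rnd (L k i) + 1, pc := WaitBin 0\<rparr>)"
      using 2 j Ret assms
      by (simp add: c_Suc step_def Let_def b'_def s'_def view_of_def mark_bval_def)
    moreover have "net (c (Suc k)) = net (c k) \<union> bcast n i (BVAL (rnd (L k i) + 1, 0) (est s'))"
      using 2 j Ret assms
      by (simp add: c_Suc step_def Let_def b'_def s'_def view_of_def)
    ultimately show ?thesis
      using mv by (intro exI[of _ "{BVAL (rnd (L k i) + 1, 0) (est s')}"]) simp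
  next
    case 3
    show ?thesis
      using 3 j Ret assms move.ret1[OF 3 qual refl, of k i]
      by (intro exI[of _ "{BVAL (rnd (L k i), 1) (singleton_value (auxset_union (L k i) (rnd (L k i)) J))}"])
         (simp add: c_Suc step_def Let_def singleton_value_def auxset_union_def mark_bval_def)
  next
    \<comment> \<open>Such control points are unreachable, but \<open>pc_cases\<close> is itself
      derived from this lemma; here it is enough that the step changes nothing.\<close>
    case 4
    then show ?thesis
      using j Ret assms move.idle[of k i] by (intro exI[of _ "{}"]) (simp add: c_Suc step_def Let_def)
  qed
qed (use assms in \<open>auto simp: valid_local_def\<close>)

text \<open>A delivery removes a message and other processes may add theirs, so \<open>net\<close>
  is described only with respect to the sender \<open>i\<close>, and by two inclusions instead of an
  equation.\<close>

lemma other_move: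
  assumes "i \<in> C" "\<not> valid_local n t F i (a k) (c k)"
  shows "\<exists>Ms. move k i (L k i) Ms (L (Suc k) i) \<and>
    (\<Union>m\<in>Ms. bcast n i m) \<subseteq> net (c (Suc k)) \<and>
    {x \<in> net (c (Suc k)). fst x = i} \<subseteq> net (c k) \<union> (\<Union>m\<in>Ms. bcast n i m)"
proof -
  have recv_src: "(i, j, m) \<in> snd (recv n t dst src m' s) \<Longrightarrow> i = dst" for dst src m' s j m
    by (cases m') (auto simp: bcast_def Let_def split: if_splits)
  have idle: ?thesis if "L (Suc k) i = L k i" "{x \<in> net (c (Suc k)). fst x = i} \<subseteq> net (c k)"
    using that move.idle[of k i "L k i"] by (intro exI[of _ "{}"]) auto
  show ?thesis
  proof (cases "a k")
    case (Deliver src dst m)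
    show ?thesis
    proof (cases "(src, dst, m) \<in> net (c k) \<and> dst = i")
      case True
      then obtain Ms where "move k i (L k i) Ms (fst (recv n t i src m (L k i)))"
        "snd (recv n t i src m (L k i)) = (\<Union>m\<in>Ms. bcast n i m)"
        using recv_move[of src i m k "L k i"] by auto
      then show ?thesis
        using True assms Deliver
        by (intro exI[of _ Ms]) (auto simp: c_Suc step_def split: prod.splits)
    next
      case False
      then show ?thesis
        using Deliver recv_src
        by (intro idle) (auto simp: c_Suc step_def split: prod.splits, metis snd_conv)
    qed
  next
    case (Byz src dst m)
    show ?thesis
    proof (cases "src \<in> F \<and> dst = i")
      case True
      then obtain Ms where "move k i (L k i) Ms (fst (recv n t i src m (L k i)))"
        "snd (recv n t i src m (L k i)) = (\<Union>m\<in>Ms. bcast n i m)"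
        using recv_move[of src i m k "L k i"] by auto
      then show ?thesis
        using True assms Byz
        by (intro exI[of _ Ms]) (auto simp: c_Suc step_def split: prod.splits)
    next
      case False
      then show ?thesis
        using Byz recv_src
        by (intro idle) (auto simp: c_Suc step_def split: prod.splits, metis snd_conv)
    qed
  next
    case (AuxStep j v)
    have "j \<noteq> i \<or> \<not> valid_local n t F j (a k) (c k)"
      using assms by auto
    then show ?thesis
      by (intro idle) (auto simp: AuxStep c_Suc step_def Let_def bcast_def split: phase.splits)
  next
    case (Ret j J b)
    have "j \<noteq> i \<or> \<not> valid_local n t F j (a k) (c k)"
      using assms by auto
    then show ?thesis
      by (intro idle) (auto simp: Ret c_Suc step_def Let_def bcast_def split: phase.splits nat.splits)
  next
    case Skip
    then show ?thesis
      by (intro idle) (auto simp: c_Suc step_def)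
  qed
qed


lemma n_pos: "0 < n"
  using resilience by simp

lemma step_move:
  assumes "i \<in> C"
  obtains Ms where "move k i (L k i) Ms (L (Suc k) i)" "(\<Union>m\<in>Ms. bcast n i m) \<subseteq> net (c (Suc k))"
    "{x \<in> net (c (Suc k)). fst x = i} \<subseteq> net (c k) \<union> (\<Union>m\<in>Ms. bcast n i m)"
  using local_move[OF assms, of k] other_move[OF assms, of k] by (cases "valid_local n t F i (a k) (c k)") blast+

text \<open>Delivery removes a message from \<open>net\<close>, hence the quantification over the past.\<close>

definition sent :: "nat \<Rightarrow> nat \<Rightarrow> msg \<Rightarrow> bool" where
  "sent k i m \<longleftrightarrow> (\<exists>k'\<le>k. \<exists>j. (i, j, m) \<in> net (c k'))"

lemma sent_mono: "sent k i m \<Longrightarrow> k \<le> k' \<Longrightarrow> sent k' i m"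
  unfolding sent_def using le_trans by blast

lemma sent_netI: "(i, j, m) \<in> net (c k) \<Longrightarrow> sent k i m"
  unfolding sent_def by blast

lemma sent_0: "sent 0 i m \<longleftrightarrow> i \<in> C \<and> m = BVAL (1, 0) (Some (inp i))"
  using n_pos by (auto simp: sent_def c_0 init_def)

lemma sent_Suc: "sent (Suc k) i m \<longleftrightarrow> sent k i m \<or> (\<exists>j. (i, j, m) \<in> net (c (Suc k)))"
  unfolding sent_def by (auto simp: le_Suc_eq)

text \<open>Passing from \<open>net\<close> to \<open>sent\<close> turns the inclusions of
  \<open>step_move\<close> into an equivalence, because deliveries no longer matter. A new broadcast
  counts as sent since its copy for process \<open>0\<close> exists.\<close>

lemma sent_step:
  assumes "i \<in> C"
  obtains Ms where "move k i (L k i) Ms (L (Suc k) i)" "(\<Union>m\<in>Ms. bcast n i m) \<subseteq> net (c (Suc k))"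
    "\<And>m. sent (Suc k) i m \<longleftrightarrow> sent k i m \<or> m \<in> Ms"
proof -
  obtain Ms where Ms: "move k i (L k i) Ms (L (Suc k) i)" "(\<Union>m\<in>Ms. bcast n i m) \<subseteq> net (c (Suc k))"
    "{x \<in> net (c (Suc k)). fst x = i} \<subseteq> net (c k) \<union> (\<Union>m\<in>Ms. bcast n i m)"
    using step_move[OF assms] .
  have "sent (Suc k) i m \<longleftrightarrow> sent k i m \<or> m \<in> Ms" for m
  proof
    assume "sent (Suc k) i m"
    then consider "sent k i m" | j where "(i, j, m) \<in> net (c (Suc k))"
      by (auto simp: sent_Suc)
    then show "sent k i m \<or> m \<in> Ms"
    proof cases
      case 2
      then have "(i, j, m) \<in> net (c k) \<union> (\<Union>m\<in>Ms. bcast n i m)"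
        using Ms(3) by auto
      then show ?thesis by (auto simp: bcast_def intro: sent_netI)
    qed simp
  next
    assume "sent k i m \<or> m \<in> Ms"
    then show "sent (Suc k) i m"
    proof
      assume "m \<in> Ms"
      then have "(i, 0, m) \<in> net (c (Suc k))"
        using Ms(2) n_pos by (auto simp: bcast_def)
      then show ?thesis by (rule sent_netI)
    qed (simp add: sent_Suc)
  qed
  with Ms that show thesis by blast
qed

text \<open>All copies of a broadcast enter \<open>net\<close> in the same step. This is the
  starting point for the delivery assumption, as single copies may be gone later.\<close>

lemma sent_all:
  assumes "i \<in> C" "sent k i m"
  shows "\<exists>k'\<le>k. \<forall>j<n. (i, j, m) \<in> net (c k')"
  using assms(2)
proof (induction k)
  case 0
  then show ?case by (auto simp: sent_0) (auto simp: c_0 init_def)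
next
  case (Suc k)
  obtain Ms where Ms: "(\<Union>m\<in>Ms. bcast n i m) \<subseteq> net (c (Suc k))"
    "\<And>m. sent (Suc k) i m \<longleftrightarrow> sent k i m \<or> m \<in> Ms"
    using sent_step[OF assms(1), of k] by metis
  show ?case
  proof (cases "sent k i m")
    case True
    then show ?thesis using Suc.IH le_SucI by blast
  next
    case False
    with Suc.prems Ms have "bcast n i m \<subseteq> net (c (Suc k))" by blast
    then show ?thesis by (intro exI[of _ "Suc k"]) (auto simp: bcast_def)
  qed
qed

section \<open>Control points and stages\<close>

lemma pc_cases:
  assumes "i \<in> C"
  shows "pc (L k i) \<in> {WaitBin 0, WaitBin 1, WaitAux 0, WaitAux 1, WaitAuxSet}"
proof (induction k)
  case 0
  then show ?case by (simp add: c_0 init_def)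
next
  case (Suc k)
  obtain Ms where "move k i (L k i) Ms (L (Suc k) i)"
    using step_move[OF assms] .
  then show ?case
    using Suc.IH by cases auto
qed

lemma rnd_pos: "i \<in> C \<Longrightarrow> 1 \<le> rnd (L k i)"
proof (induction k)
  case (Suc k)
  obtain Ms where "move k i (L k i) Ms (L (Suc k) i)"
    using step_move[OF Suc.prems] .
  then show ?case
    using Suc by cases auto
qed (simp add: c_0 init_def)

lemma stage_0: "stage (L 0 i) = 5"
  by (simp add: stage_def c_0 init_def)

lemma idle_local:
  assumes "i \<in> C" "\<not> valid_local n t F i (a k) (c k)"
  shows "est (L (Suc k) i) = est (L k i)" "rnd (L (Suc k) i) = rnd (L k i)" "pc (L (Suc k) i) = pc (L k i)"
    "dec (L (Suc k) i) = dec (L k i)"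
proof -
  have recv: "est (fst (recv n t dst src m s)) = est s" "rnd (fst (recv n t dst src m s)) = rnd s"
    "pc (fst (recv n t dst src m s)) = pc s" "dec (fst (recv n t dst src m s)) = dec s" for dst src m s
    by (cases m; simp add: Let_def)+
  have "est (L (Suc k) i) = est (L k i) \<and> rnd (L (Suc k) i) = rnd (L k i) \<and> pc (L (Suc k) i) = pc (L k i) \<and>
    dec (L (Suc k) i) = dec (L k i)"
  proof (cases "a k")
    case (Deliver src dst m)
    then show ?thesis
      using recv[of dst src m "L k dst"] by (auto simp: c_Suc step_def split: prod.splits)
  next
    case (Byz src dst m)
    then show ?thesis
      using recv[of dst src m "L k dst"] by (auto simp: c_Suc step_def split: prod.splits)
  next
    case (AuxStep j v)
    have "j \<noteq> i \<or> \<not> valid_local n t F j (a k) (c k)"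
      using assms by auto
    then show ?thesis
      by (auto simp: AuxStep c_Suc step_def Let_def split: phase.splits)
  next
    case (Ret j J b)
    have "j \<noteq> i \<or> \<not> valid_local n t F j (a k) (c k)"
      using assms by auto
    then show ?thesis
      by (auto simp: Ret c_Suc step_def Let_def split: phase.splits nat.splits)
  qed (auto simp: c_Suc step_def)
  then show "est (L (Suc k) i) = est (L k i)" "rnd (L (Suc k) i) = rnd (L k i)" "pc (L (Suc k) i) = pc (L k i)"
    "dec (L (Suc k) i) = dec (L k i)" by auto
qed

lemma stage_Suc:
  assumes "i \<in> C"
  shows "stage (L (Suc k) i) = stage (L k i) + (if valid_local n t F i (a k) (c k) then 1 else 0)"
proof (cases "valid_local n t F i (a k) (c k)")
  case False
  then show ?thesis
    using idle_local[OF assms False] by (simp add: stage_def)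
next
  case True
  show ?thesis
  proof (cases "a k")
    case (AuxStep j v)
    with True show ?thesis
      by (auto simp: valid_local_def auxok_def c_Suc step_def Let_def stage_def split: phase.splits)
  next
    case (Ret j J b)
    with True pc_cases[OF assms, of k] show ?thesis
      by (auto simp: valid_local_def qual_def c_Suc step_def Let_def stage_def split: phase.splits)
  qed (use True in \<open>auto simp: valid_local_def\<close>)
qed

lemma mono_stage: "i \<in> C \<Longrightarrow> k \<le> k' \<Longrightarrow> stage (L k i) \<le> stage (L k' i)"
  by (rule lift_Suc_mono_le) (auto simp: stage_Suc)

text \<open>The stage starts at 5, the beginning of round 1, and grows in unit steps, so no control
  point is skipped.\<close>

lemma stage_attained:
  assumes "i \<in> C" "5 \<le> q" "q \<le> stage (L k i)"
  shows "\<exists>k'\<le>k. stage (L k' i) = q"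
  using assms(3)
proof (induction k)
  case 0
  then show ?case using assms(2) by (simp add: stage_0)
next
  case (Suc k)
  show ?case
  proof (cases "q \<le> stage (L k i)")
    case True
    then show ?thesis using Suc.IH le_SucI by blast
  next
    case False
    then show ?thesis
      using Suc.prems stage_Suc[OF assms(1), of k] by (intro exI[of _ "Suc k"]) (auto split: if_splits)
  qed
qed

lemma stage_cases:
  assumes "i \<in> C"
  shows "stage (L k i) = 5 * r \<longleftrightarrow> rnd (L k i) = r \<and> pc (L k i) = WaitBin 0"
    "stage (L k i) = 5 * r + 1 \<longleftrightarrow> rnd (L k i) = r \<and> pc (L k i) = WaitAux 0"
    "stage (L k i) = 5 * r + 2 \<longleftrightarrow> rnd (L k i) = r \<and> pc (L k i) = WaitAuxSet"
    "stage (L k i) = 5 * r + 3 \<longleftrightarrow> rnd (L k i) = r \<and> pc (L k i) = WaitBin 1"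
    "stage (L k i) = 5 * r + 4 \<longleftrightarrow> rnd (L k i) = r \<and> pc (L k i) = WaitAux 1"
proof -
  define p :: nat where "p = (case pc (L k i) of WaitBin q \<Rightarrow> 3 * q | WaitAux q \<Rightarrow> 3 * q + 1 | WaitAuxSet \<Rightarrow> 2)"
  have p: "p = 0 \<longleftrightarrow> pc (L k i) = WaitBin 0" "p = 1 \<longleftrightarrow> pc (L k i) = WaitAux 0" "p = 2 \<longleftrightarrow> pc (L k i) = WaitAuxSet"
    "p = 3 \<longleftrightarrow> pc (L k i) = WaitBin 1" "p = 4 \<longleftrightarrow> pc (L k i) = WaitAux 1" "p < 5"
    using pc_cases[OF assms, of k] unfolding p_def by auto
  have "stage (L k i) = 5 * rnd (L k i) + p"
    by (simp add: stage_def p_def)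
  moreover have "(5 * x + y) div 5 = x" "(5 * x + y) mod 5 = y" if "y < 5" for x y :: nat
    using that by simp_all
  ultimately have *: "stage (L k i) = 5 * r + q \<longleftrightarrow> rnd (L k i) = r \<and> p = q" if "q < 5" for q
    using that p(6) by metis
  show "stage (L k i) = 5 * r \<longleftrightarrow> rnd (L k i) = r \<and> pc (L k i) = WaitBin 0"
    using *[of 0] p(1) by simp
  show "stage (L k i) = 5 * r + 1 \<longleftrightarrow> rnd (L k i) = r \<and> pc (L k i) = WaitAux 0"
    using *[of 1] p(2) by simp
  show "stage (L k i) = 5 * r + 2 \<longleftrightarrow> rnd (L k i) = r \<and> pc (L k i) = WaitAuxSet"
    using *[of 2] p(3) by simp
  show "stage (L k i) = 5 * r + 3 \<longleftrightarrow> rnd (L k i) = r \<and> pc (L k i) = WaitBin 1"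
    using *[of 3] p(4) by simp
  show "stage (L k i) = 5 * r + 4 \<longleftrightarrow> rnd (L k i) = r \<and> pc (L k i) = WaitAux 1"
    using *[of 4] p(5) by simp
qed

lemma rnd_stage: "i \<in> C \<Longrightarrow> rnd (L k i) = stage (L k i) div 5"
  using pc_cases[of i k] by (auto simp: stage_def)

lemma mono_rnd: "i \<in> C \<Longrightarrow> k \<le> k' \<Longrightarrow> rnd (L k i) \<le> rnd (L k' i)"
  by (simp add: rnd_stage mono_stage div_le_mono)

section \<open>Persistence and authenticity of received messages\<close>

lemma mono_bvrecv: "i \<in> C \<Longrightarrow> k \<le> k' \<Longrightarrow> bvrecv (L k i) T x \<subseteq> bvrecv (L k' i) T x"
proof (rule lift_Suc_mono_le[of "\<lambda>k. bvrecv (L k i) T x"])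
  fix k assume "i \<in> C"
  obtain Ms where "move k i (L k i) Ms (L (Suc k) i)"
    using step_move[OF \<open>i \<in> C\<close>] .
  then show "bvrecv (L k i) T x \<subseteq> bvrecv (L (Suc k) i) T x"
    by cases auto
qed

text \<open>\<open>recv\<close> stores only the first AUX message per sender and tag, so even a
  Byzantine sender cannot revise an entry.\<close>

lemma auxrecv_stable:
  assumes "i \<in> C" "k \<le> k'" "auxrecv (L k i) T j = Some v"
  shows "auxrecv (L k' i) T j = Some v"
  using assms(2)
proof (induction k' rule: dec_induct)
  case (step k')
  obtain Ms where "move k' i (L k' i) Ms (L (Suc k') i)"
    using step_move[OF assms(1)] .
  then show ?case
    using step.IH by cases auto
qed (fact assms)

lemma auxsrecv_stable:
  assumes "i \<in> C" "k \<le> k'" "auxsrecv (L k i) r j = Some S"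
  shows "auxsrecv (L k' i) r j = Some S"
  using assms(2)
proof (induction k' rule: dec_induct)
  case (step k')
  obtain Ms where "move k' i (L k' i) Ms (L (Suc k') i)"
    using step_move[OF assms(1)] .
  then show ?case
    using step.IH by cases auto
qed (fact assms)

lemma dec_stable:
  assumes "i \<in> C" "k \<le> k'" "dec (L k i) = Some y"
  shows "dec (L k' i) = Some y"
  using assms(2)
proof (induction k' rule: dec_induct)
  case (step k')
  obtain Ms where "move k' i (L k' i) Ms (L (Suc k') i)"
    using step_move[OF assms(1)] .
  then show ?case
    using step.IH by cases (auto simp: step8_def Let_def)
qed (fact assms)

lemma bvrecv_subset: "i \<in> C \<Longrightarrow> bvrecv (L k i) T x \<subseteq> {0..<n}"
proof (induction k arbitrary: T x)
  case (Suc k)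
  obtain Ms where "move k i (L k i) Ms (L (Suc k) i)"
    using step_move[OF Suc.prems] .
  moreover have "src < n" if "src \<in> F \<or> (src, i, m) \<in> net (c k)" for src m
    using that
  proof
    assume "src \<in> F"
    with F_subset have "src \<in> {0..<n}" by (rule subsetD)
    then show ?thesis by simp
  next
    assume "(src, i, m) \<in> net (c k)"
    then show ?thesis by (intro C_less) (simp add: net_correct)
  qed
  ultimately show ?case
    using Suc.IH[OF Suc.prems] by cases simp_all
qed (simp add: c_0 init_def)

lemma finite_bvrecv: "i \<in> C \<Longrightarrow> finite (bvrecv (L k i) T x)"
  using bvrecv_subset by (rule finite_subset) simp_all

lemma mono_bin: "i \<in> C \<Longrightarrow> k \<le> k' \<Longrightarrow> bin t (L k i) T \<subseteq> bin t (L k' i) T"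
  by (auto simp: bin_def intro: order_trans[OF _ card_mono[OF finite_bvrecv mono_bvrecv]])

text \<open>Authenticity of channels: a correct \<open>j\<close> is not in \<open>F\<close>, so its
  entry stems from a message in transit, and \<open>sent\<close> remembers that message after its
  delivery. The same argument serves AUX and AUXSET.\<close>

lemma bvrecv_sent:
  assumes "i \<in> C" "j \<in> C"
  shows "j \<in> bvrecv (L k i) T x \<Longrightarrow> sent k j (BVAL T x)"
proof (induction k arbitrary: T x)
  case (Suc k)
  obtain Ms where "move k i (L k i) Ms (L (Suc k) i)"
    using step_move[OF assms(1)] .
  then have "sent k j (BVAL T x)"
    using Suc assms by cases (auto simp: correct_def intro: sent_netI split: if_splits)
  then show ?case by (rule sent_mono) simp
qed (simp add: c_0 init_def)

lemma auxrecv_sent: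
  assumes "i \<in> C" "j \<in> C"
  shows "auxrecv (L k i) T j = Some v \<Longrightarrow> sent k j (AUX T v)"
proof (induction k arbitrary: T v)
  case (Suc k)
  obtain Ms where "move k i (L k i) Ms (L (Suc k) i)"
    using step_move[OF assms(1)] .
  then have "sent k j (AUX T v)"
    using Suc assms by cases (auto simp: correct_def intro: sent_netI split: if_splits)
  then show ?case by (rule sent_mono) simp
qed (simp add: c_0 init_def)

lemma auxsrecv_sent:
  assumes "i \<in> C" "j \<in> C"
  shows "auxsrecv (L k i) r j = Some S \<Longrightarrow> sent k j (AUXSET r S)"
proof (induction k arbitrary: r S)
  case (Suc k)
  obtain Ms where "move k i (L k i) Ms (L (Suc k) i)"
    using step_move[OF assms(1)] .
  then have "sent k j (AUXSET r S)"
    using Suc assms by cases (auto simp: correct_def intro: sent_netI split: if_splits)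
  then show ?case by (rule sent_mono) simp
qed (simp add: c_0 init_def)

lemma bvsent_sent:
  assumes "i \<in> C"
  shows "bvsent (L k i) T x \<longleftrightarrow> sent k i (BVAL T x)"
proof (induction k arbitrary: T x)
  case 0
  then show ?case using assms by (auto simp: c_0 init_def sent_0)
next
  case (Suc k)
  obtain Ms where "move k i (L k i) Ms (L (Suc k) i)" "\<And>m. sent (Suc k) i m \<longleftrightarrow> sent k i m \<or> m \<in> Ms"
    using sent_step[OF assms, of k] by metis
  then show ?case
    using Suc.IH by cases auto
qed


section \<open>Inputs, views and quorums\<close>

text \<open>The estimate does not change while \<open>tag_of\<close> stays the same, so it is the input of the
  SBV-Broadcast with that tag.\<close>

definition Input :: "nat \<Rightarrow> nat \<Rightarrow> tag \<Rightarrow> val \<Rightarrow> bool" where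
  "Input k i T x \<longleftrightarrow> (\<exists>k'\<le>k. est (L k' i) = x \<and> tag_of (L k' i) = T)"

lemma Input_mono: "Input k i T x \<Longrightarrow> k \<le> k' \<Longrightarrow> Input k' i T x"
  unfolding Input_def using le_trans by blast

lemma Input_now: "est (L k i) = x \<Longrightarrow> tag_of (L k i) = T \<Longrightarrow> Input k i T x"
  unfolding Input_def by blast

lemma Input_init: "Input 0 i T x \<longleftrightarrow> T = (1, 0) \<and> x = Some (inp i)"
  by (auto simp: Input_def c_0 init_def tag_of_def)

lemma Input_step: "Input (Suc k) i T x \<longleftrightarrow> Input k i T x \<or> est (L (Suc k) i) = x \<and> tag_of (L (Suc k) i) = T"
  unfolding Input_def by (auto simp: le_Suc_eq)

lemma Input_round: "i \<in> C \<Longrightarrow> Input k i (r, q) x \<Longrightarrow> 1 \<le> r"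
  using rnd_pos by (auto simp: Input_def tag_of_def)

text \<open>A relay needs \<open>t + 1\<close> senders, one of which is correct and sent the value
  earlier, so the induction on time leads back to a process that broadcast its own estimate.\<close>

lemma sent_bval_Input:
  "j \<in> C \<Longrightarrow> sent k j (BVAL T x) \<Longrightarrow> \<exists>i\<in>C. Input k i T x"
proof (induction k arbitrary: j T x)
  case 0
  then show ?case by (auto simp: sent_0 Input_init)
next
  case (Suc k)
  have old: ?case if "j' \<in> C" "sent k j' (BVAL T x)" for j'
    using Suc.IH[OF that] Input_mono[of k _ T x "Suc k"] by auto
  obtain Ms where mv: "move k j (L k j) Ms (L (Suc k) j)"
    and Ms: "\<And>m. sent (Suc k) j m \<longleftrightarrow> sent k j m \<or> m \<in> Ms"
    using sent_step[OF Suc.prems(1), of k] by metis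
  show ?case
  proof (cases "sent k j (BVAL T x)")
    case True
    then show ?thesis using old Suc.prems by blast
  next
    case False
    with Suc.prems Ms have "BVAL T x \<in> Ms" by blast
    with mv show ?thesis
    proof cases
      case (relay src T' x')
      then have src: "src \<in> F \<or> (src, j, BVAL T x) \<in> net (c k)"
        and card: "t < card (insert src (bvrecv (L k j) T x))"
        using \<open>BVAL T x \<in> Ms\<close> by auto
      have "src < n"
        using src F_subset net_correct C_less by fastforce
      then have "insert src (bvrecv (L k j) T x) \<subseteq> {0..<n}"
        using bvrecv_subset[OF Suc.prems(1)] by simp
      with card obtain j' where j': "j' \<in> insert src (bvrecv (L k j) T x)" "j' \<in> C"
        by (rule correct_in_large)
      have "sent k j' (BVAL T x)"
      \<comment> \<open>The message being received right now is not yet recorded in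
        \<open>bvrecv\<close>; that it was sent is read off \<open>net\<close>.\<close>
      proof (cases "j' = src")
        case True
        with src j'(2) have "(src, j, BVAL T x) \<in> net (c k)"
          by (simp add: correct_def)
        with True show ?thesis by (simp add: sent_netI)
      next
        case False
        with j' show ?thesis
          by (intro bvrecv_sent[OF Suc.prems(1)]) simp_all
      qed
      with j' old show ?thesis by blast
    next
      case (ret1 J e)
      then have "Input (Suc k) j T x"
        using \<open>BVAL T x \<in> Ms\<close> by (intro Input_now) (auto simp: tag_of_def)
      then show ?thesis using Suc.prems by blast
    next
      case (ret2 J s' b)
      then have "Input (Suc k) j T x"
        using \<open>BVAL T x \<in> Ms\<close> by (intro Input_now) (auto simp: tag_of_def)
      then show ?thesis using Suc.prems by blast
    qed simp_all
  qed
qed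

lemma bin_Input:
  assumes "i \<in> C" "x \<in> bin t (L k i) T"
  shows "\<exists>j\<in>C. Input k j T x"
proof -
  have "t < card (bvrecv (L k i) T x)"
    using assms by (simp add: bin_def)
  then obtain j where "j \<in> bvrecv (L k i) T x" "j \<in> C"
    using correct_in_large bvrecv_subset[OF assms(1)] by metis
  then show ?thesis
    using sent_bval_Input bvrecv_sent[OF assms(1)] by metis
qed

section \<open>Uniqueness of AUX and AUXSET messages, intersection of views\<close>

lemma sent_aux:
  assumes "i \<in> C" "sent k i (AUX (r, q) v)"
  shows "5 * r + 3 * q < stage (L k i) \<and> v \<in> bin t (L k i) (r, q)"
  using assms(2)
proof (induction k)
  case 0
  then show ?case by (simp add: sent_0)
next
  case (Suc k)
  obtain Ms where mv: "move k i (L k i) Ms (L (Suc k) i)"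
    and Ms: "\<And>m. sent (Suc k) i m \<longleftrightarrow> sent k i m \<or> m \<in> Ms"
    using sent_step[OF assms(1), of k] by metis
  show ?case
  proof (cases "sent k i (AUX (r, q) v)")
    case True
    then show ?thesis
      using Suc.IH mono_stage[OF assms(1), of k "Suc k"] mono_bin[OF assms(1), of k "Suc k" "(r, q)"] by auto
  next
    case False
    with Suc.prems Ms have "AUX (r, q) v \<in> Ms" by blast
    with mv show ?thesis
      by cases (auto simp: stage_def bin_def)
  qed
qed

text \<open>An AUX message with tag \<open>(r, q)\<close> leaves only at stage
  \<open>5 * r + 3 * q\<close>, and by \<open>sent_aux\<close> a process that has already sent one
  is beyond that stage.\<close>

lemma aux_unique:
  assumes "i \<in> C" "sent k i (AUX T v)" "sent k i (AUX T v')"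
  shows "v = v'"
  using assms(2,3)
proof (induction k)
  case 0
  then show ?case by (simp add: sent_0)
next
  case (Suc k)
  obtain Ms where mv: "move k i (L k i) Ms (L (Suc k) i)"
    and Ms: "\<And>m. sent (Suc k) i m \<longleftrightarrow> sent k i m \<or> m \<in> Ms"
    using sent_step[OF assms(1), of k] by metis
  have new: "AUX T u \<in> Ms \<Longrightarrow> \<not> sent k i (AUX T u')" for u u'
    using mv sent_aux[OF assms(1), of k "fst T" "snd T" u'] by cases (auto simp: stage_def)
  have "AUX T v \<in> Ms \<Longrightarrow> AUX T v' \<in> Ms \<Longrightarrow> v = v'"
    using mv by cases auto
  then show ?case
    using Suc Ms new by blast
qed

text \<open>The quorum is tested against the present state, not against the state at the return of
  the SBV-Broadcast. Since stored messages are never changed and \<open>bin\<close> only grows, a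
  view once taken remains one, and views taken at different times can be compared.\<close>

definition is_view :: "lstate \<Rightarrow> tag \<Rightarrow> val set \<Rightarrow> bool" where
  "is_view s T W \<longleftrightarrow> (\<exists>J\<subseteq>{0..<n}. n - t \<le> card J \<and>
    (\<forall>j\<in>J. \<exists>v. auxrecv s T j = Some v \<and> v \<in> bin t s T) \<and> W = view_of s T J)"

lemma is_view_qual:
  "qual n t s J \<Longrightarrow> pc s = WaitAux q \<Longrightarrow> is_view s (rnd s, q) (view_of s (rnd s, q) J)"
  unfolding is_view_def qual_def by auto

lemma is_view_mono:
  assumes "i \<in> C" "k \<le> k'" "is_view (L k i) T W"
  shows "is_view (L k' i) T W"
proof -
  obtain J where J: "J \<subseteq> {0..<n}" "n - t \<le> card J"
    "\<forall>j\<in>J. \<exists>v. auxrecv (L k i) T j = Some v \<and> v \<in> bin t (L k i) T" "W = view_of (L k i) T J"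
    using assms(3) unfolding is_view_def by blast
  have eq: "auxrecv (L k' i) T j = auxrecv (L k i) T j" if "j \<in> J" for j
    using that J(3) auxrecv_stable[OF assms(1,2)] by fastforce
  then have "\<forall>j\<in>J. \<exists>v. auxrecv (L k' i) T j = Some v \<and> v \<in> bin t (L k' i) T"
    using J(3) mono_bin[OF assms(1,2), of T] by fastforce
  moreover have "W = view_of (L k' i) T J"
    using eq by (simp add: J(4) view_of_def)
  ultimately show ?thesis
    unfolding is_view_def using J(1,2) by blast
qed

lemma is_view_subset_bin: "is_view s T W \<Longrightarrow> W \<subseteq> bin t s T"
  unfolding is_view_def view_of_def by fastforce

lemma view_Input:
  assumes "i \<in> C" "is_view (L k i) T W" "x \<in> W"
  shows "\<exists>j\<in>C. Input k j T x"
proof -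
  have "x \<in> bin t (L k i) T"
    using is_view_subset_bin assms(2,3) by blast
  with assms(1) show ?thesis by (rule bin_Input)
qed

lemma view_inter:
  assumes "i \<in> C" "is_view (L k i) T W" "i' \<in> C" "is_view (L k' i') T W'"
  shows "W \<inter> W' \<noteq> {}"
proof -
  obtain J where J: "J \<subseteq> {0..<n}" "n - t \<le> card J"
    "\<forall>j\<in>J. \<exists>v. auxrecv (L k i) T j = Some v" "W = view_of (L k i) T J"
    using assms(2) unfolding is_view_def by blast
  obtain J' where J': "J' \<subseteq> {0..<n}" "n - t \<le> card J'"
    "\<forall>j\<in>J'. \<exists>v. auxrecv (L k' i') T j = Some v" "W' = view_of (L k' i') T J'"
    using assms(4) unfolding is_view_def by blast
  obtain j where j: "j \<in> J" "j \<in> J'" "j \<in> C"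
    using quorum_inter[OF J(1,2) J'(1,2)] .
  obtain v v' where v: "auxrecv (L k i) T j = Some v" "auxrecv (L k' i') T j = Some v'"
    using J(3) J'(3) j by blast
  then have "sent (max k k') j (AUX T v)" "sent (max k k') j (AUX T v')"
    using auxrecv_sent assms j sent_mono by (metis max.cobounded1, metis max.cobounded2)
  then have "v = v'"
    using aux_unique j by blast
  then have "v \<in> W \<inter> W'"
    using v j J(4) J'(4) by (auto simp: view_of_def)
  then show ?thesis by blast
qed

lemma sent_auxset:
  assumes "i \<in> C" "sent k i (AUXSET r S)"
  shows "5 * r + 1 < stage (L k i) \<and> is_view (L k i) (r, 0) S"
  using assms(2)
proof (induction k)
  case 0
  then show ?case by (simp add: sent_0)
next
  case (Suc k)
  obtain Ms where mv: "move k i (L k i) Ms (L (Suc k) i)"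
    and Ms: "\<And>m. sent (Suc k) i m \<longleftrightarrow> sent k i m \<or> m \<in> Ms"
    using sent_step[OF assms(1), of k] by metis
  show ?case
  proof (cases "sent k i (AUXSET r S)")
    case True
    then show ?thesis
      using Suc.IH mono_stage[OF assms(1), of k "Suc k"] is_view_mono[OF assms(1), of k "Suc k" "(r, 0)"] by auto
  next
    case False
    with Suc.prems Ms have "AUXSET r S \<in> Ms" by blast
    with mv show ?thesis
    proof cases
      case (ret0 J)
      then have "is_view (L k i) (r, 0) S"
        using is_view_qual[OF ret0(4,3)] \<open>AUXSET r S \<in> Ms\<close> by simp
      then have "is_view (L (Suc k) i) (r, 0) S"
        by (rule is_view_mono[OF assms(1), rotated]) simp
      then show ?thesis
        using ret0 \<open>AUXSET r S \<in> Ms\<close> by (simp add: stage_def)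
    qed simp_all
  qed
qed

lemma auxset_unique:
  assumes "i \<in> C" "sent k i (AUXSET r S)" "sent k' i (AUXSET r S')"
  shows "S = S'"
proof -
  have "sent m i (AUXSET r S) \<Longrightarrow> sent m i (AUXSET r S') \<Longrightarrow> S = S'" for m
  proof (induction m)
    case 0
    then show ?case by (simp add: sent_0)
  next
    case (Suc m)
    obtain Ms where mv: "move m i (L m i) Ms (L (Suc m) i)"
      and Ms: "\<And>x. sent (Suc m) i x \<longleftrightarrow> sent m i x \<or> x \<in> Ms"
      using sent_step[OF assms(1), of m] by metis
    have new: "AUXSET r X \<in> Ms \<Longrightarrow> \<not> sent m i (AUXSET r X')" for X X'
      using mv sent_auxset[OF assms(1), of m r X'] by cases (auto simp: stage_def)
    have "AUXSET r S \<in> Ms \<Longrightarrow> AUXSET r S' \<in> Ms \<Longrightarrow> S = S'"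
      using mv by cases auto
    then show ?case
      using Suc Ms new by blast
  qed
  then show ?thesis
    using assms(2,3) sent_mono by (metis max.cobounded1 max.cobounded2)
qed

text \<open>The set is a view, and \<open>view_inter\<close> applied to a view and itself excludes
  the empty one.\<close>

lemma auxset_nonempty: "i \<in> C \<Longrightarrow> sent k i (AUXSET r S) \<Longrightarrow> S \<noteq> {}"
  using sent_auxset view_inter by blast

definition is_union :: "lstate \<Rightarrow> nat \<Rightarrow> val set \<Rightarrow> bool" where
  "is_union s r U \<longleftrightarrow> (\<exists>J\<subseteq>{0..<n}. n - t \<le> card J \<and>
    (\<forall>j\<in>J. \<exists>S. auxsrecv s r j = Some S \<and> S \<subseteq> bin t s (r, 0)) \<and> U = auxset_union s r J)"

lemma is_union_qual:
  "qual n t s J \<Longrightarrow> pc s = WaitAuxSet \<Longrightarrow> is_union s (rnd s) (auxset_union s (rnd s) J)"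
  unfolding is_union_def qual_def by auto

lemma is_union_mono:
  assumes "i \<in> C" "k \<le> k'" "is_union (L k i) r U"
  shows "is_union (L k' i) r U"
proof -
  obtain J where J: "J \<subseteq> {0..<n}" "n - t \<le> card J"
    "\<forall>j\<in>J. \<exists>S. auxsrecv (L k i) r j = Some S \<and> S \<subseteq> bin t (L k i) (r, 0)" "U = auxset_union (L k i) r J"
    using assms(3) unfolding is_union_def by blast
  have eq: "auxsrecv (L k' i) r j = auxsrecv (L k i) r j" if "j \<in> J" for j
    using that J(3) auxsrecv_stable[OF assms(1,2)] by fastforce
  then have "\<forall>j\<in>J. \<exists>S. auxsrecv (L k' i) r j = Some S \<and> S \<subseteq> bin t (L k' i) (r, 0)"
    using J(3) mono_bin[OF assms(1,2), of "(r, 0)"] by fastforce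
  moreover have "U = auxset_union (L k' i) r J"
    using eq by (simp add: J(4) auxset_union_def)
  ultimately show ?thesis
    unfolding is_union_def using J(1,2) by blast
qed

text \<open>The common message is known to be sent by each of the two times. The earlier time is
  what counts for the coin: it ties a union formed after the revelation to a message sent before
  it.\<close>

lemma union_common:
  assumes "i \<in> C" "is_union (L k i) r U" "i' \<in> C" "is_union (L k' i') r U'"
  obtains j S where "j \<in> C" "S \<noteq> {}" "S \<subseteq> U" "S \<subseteq> U'" "sent k j (AUXSET r S)" "sent k' j (AUXSET r S)"
proof -
  obtain J where J: "J \<subseteq> {0..<n}" "n - t \<le> card J"
    "\<forall>j\<in>J. \<exists>S. auxsrecv (L k i) r j = Some S" "U = auxset_union (L k i) r J"
    using assms(2) unfolding is_union_def by blast
  obtain J' where J': "J' \<subseteq> {0..<n}" "n - t \<le> card J'"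
    "\<forall>j\<in>J'. \<exists>S. auxsrecv (L k' i') r j = Some S" "U' = auxset_union (L k' i') r J'"
    using assms(4) unfolding is_union_def by blast
  obtain j where j: "j \<in> J" "j \<in> J'" "j \<in> C"
    using quorum_inter[OF J(1,2) J'(1,2)] .
  obtain S S' where S: "auxsrecv (L k i) r j = Some S" "auxsrecv (L k' i') r j = Some S'"
    using J(3) J'(3) j by blast
  then have sent: "sent k j (AUXSET r S)" "sent k' j (AUXSET r S')"
    using auxsrecv_sent assms j by blast+
  then have "S = S'"
    using auxset_unique j by blast
  show thesis
  proof
    show "S \<subseteq> U" "S \<subseteq> U'"
      using S j J(4) J'(4) \<open>S = S'\<close> by (auto simp: auxset_union_def)
  qed (use j sent \<open>S = S'\<close> auxset_nonempty in auto)
qed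

lemma union_nonempty: "i \<in> C \<Longrightarrow> is_union (L k i) r U \<Longrightarrow> U \<noteq> {}"
  using union_common by (metis subset_empty)

lemma union_Input:
  assumes "i \<in> C" "is_union (L k i) r U" "x \<in> U"
  shows "\<exists>j\<in>C. Input k j (r, 0) x"
proof -
  have "x \<in> bin t (L k i) (r, 0)"
    using assms(2,3) unfolding is_union_def auxset_union_def by fastforce
  with assms(1) show ?thesis by (rule bin_Input)
qed

section \<open>Origin of inputs and decisions\<close>

lemma Input_1:
  assumes "i \<in> C" "Input k i (r, 1) x"
  shows "\<exists>U. is_union (L k i) r U \<and> x = singleton_value U"
  using assms(2)
proof (induction k)
  case 0
  then show ?case by (simp add: Input_init)
next
  case (Suc k)
  have old: ?case if "Input k i (r, 1) x"
    using Suc.IH[OF that] is_union_mono[OF assms(1) le_SucI[OF le_refl]] by blast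
  show ?case
  proof (cases "est (L (Suc k) i) = x \<and> tag_of (L (Suc k) i) = (r, 1)")
    case False
    then show ?thesis using Suc.prems[unfolded Input_step] old by blast
  next
    case True
    obtain Ms where "move k i (L k i) Ms (L (Suc k) i)"
      using step_move[OF assms(1)] .
    then show ?thesis
    proof cases
      case (ret1 J e)
      have "is_union (L (Suc k) i) (rnd (L k i)) (auxset_union (L k i) (rnd (L k i)) J)"
        by (rule is_union_mono[OF assms(1) _ is_union_qual[OF ret1(4,3)]]) simp
      then show ?thesis
        using True ret1 by (auto simp: tag_of_def)
    \<comment> \<open>All other moves either keep both \<open>est\<close> and \<open>tag_of\<close>,
      so that the input was present before, or end in a different tag.\<close>
    qed ((rule old, rule Input_now; use True in \<open>auto simp: tag_of_def\<close>)+)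
  qed
qed

text \<open>The state \<open>s\<close> may stay arbitrary: for the three forms that
  \<open>view_1_form\<close> leaves, \<open>step8\<close> ignores the old estimate. For
  \<open>r = 0\<close> the second alternative is not ruled out here but in
  \<open>Input_0_proposed\<close>.\<close>

lemma Input_0_next:
  assumes "i \<in> C" "Input k i (Suc r, 0) x"
  shows "(r = 0 \<and> x = Some (inp i)) \<or>
    (\<exists>W b s. is_view (L k i) (r, 1) W \<and> x = est (step8 W b s) \<and> (\<forall>y. w r = CAgree y \<longrightarrow> b = y))"
  using assms(2)
proof (induction k)
  case 0
  then show ?case by (simp add: Input_init)
next
  case (Suc k)
  have old: ?case if "Input k i (Suc r, 0) x"
    using Suc.IH[OF that] is_view_mono[OF assms(1) le_SucI[OF le_refl]] by blast
  show ?case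
  proof (cases "est (L (Suc k) i) = x \<and> tag_of (L (Suc k) i) = (Suc r, 0)")
    case False
    then show ?thesis using Suc.prems[unfolded Input_step] old by blast
  next
    case True
    obtain Ms where "move k i (L k i) Ms (L (Suc k) i)"
      using step_move[OF assms(1)] .
    then show ?thesis
    proof cases
      case (ret2 J s' b)
      have "is_view (L (Suc k) i) (rnd (L k i), 1) (view_of (L k i) (rnd (L k i), 1) J)"
        by (rule is_view_mono[OF assms(1) _ is_view_qual[OF ret2(4,3)]]) simp
      moreover have "rnd (L k i) = r" "x = est (step8 (view_of (L k i) (rnd (L k i), 1) J) b (L k i))"
        using True ret2 by (auto simp: tag_of_def)
      ultimately show ?thesis
        using ret2 by blast
    qed ((rule old, rule Input_now; use True in \<open>auto simp: tag_of_def\<close>)+)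
  qed
qed

lemma dec_view:
  assumes "i \<in> C" "dec (L k i) = Some (v, r)"
  shows "r < rnd (L k i) \<and> 1 \<le> r \<and> is_view (L k i) (r, 1) {Some v}"
  using assms(2)
proof (induction k)
  case 0
  then show ?case by (simp add: c_0 init_def)
next
  case (Suc k)
  show ?case
  proof (cases "dec (L k i) = Some (v, r)")
    case True
    then show ?thesis
      using Suc.IH is_view_mono[OF assms(1) le_SucI[OF le_refl]]
        mono_rnd[OF assms(1) le_SucI[OF le_refl], of k] by auto
  next
    case False
    obtain Ms where "move k i (L k i) Ms (L (Suc k) i)"
      using step_move[OF assms(1)] .
    then show ?thesis
    proof cases
      case (ret2 J s' b)
      have "is_view (L (Suc k) i) (rnd (L k i), 1) (view_of (L k i) (rnd (L k i), 1) J)"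
        by (rule is_view_mono[OF assms(1) _ is_view_qual[OF ret2(4,3)]]) simp
      moreover have "view_of (L k i) (rnd (L k i), 1) J = {Some v} \<and> rnd (L k i) = r"
        using False Suc.prems ret2 by (auto simp: step8_def Let_def split: if_splits)
      ultimately show ?thesis
        using ret2 rnd_pos[OF assms(1), of k] by auto
    qed (use False Suc.prems in simp_all)
  qed
qed

text \<open>The conclusion allows \<open>r' \<le> r\<close> and any decided bit because a process
  that meets a singleton view after having decided keeps its older decision, whose round is smaller
  by \<open>dec_view\<close>.\<close>

lemma round_finished:
  assumes "i \<in> C" "1 \<le> r" "r < rnd (L k i)"
  shows "\<exists>W. is_view (L k i) (r, 1) W \<and>
    (\<forall>v. W = {Some v} \<longrightarrow> (\<exists>v' r'. dec (L k i) = Some (v', r') \<and> r' \<le> r))"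
  using assms(3)
proof (induction k)
  case 0
  then show ?case using assms(2) by (simp add: c_0 init_def)
next
  case (Suc k)
  show ?case
  proof (cases "r < rnd (L k i)")
    case True
    with Suc.IH obtain W where W: "is_view (L k i) (r, 1) W"
      "\<And>v. W = {Some v} \<Longrightarrow> \<exists>v' r'. dec (L k i) = Some (v', r') \<and> r' \<le> r"
      by blast
    have "is_view (L (Suc k) i) (r, 1) W"
      by (rule is_view_mono[OF assms(1) _ W(1)]) simp
    moreover have "\<exists>v' r'. dec (L (Suc k) i) = Some (v', r') \<and> r' \<le> r" if "W = {Some v}" for v
      using W(2)[OF that] dec_stable[OF assms(1) le_SucI[OF le_refl]] by metis
    ultimately show ?thesis by blast
  next
    case False
    obtain Ms where "move k i (L k i) Ms (L (Suc k) i)"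
      using step_move[OF assms(1)] .
    then show ?thesis
    proof cases
      case (ret2 J s' b)
      have "is_view (L (Suc k) i) (rnd (L k i), 1) (view_of (L k i) (rnd (L k i), 1) J)"
        by (rule is_view_mono[OF assms(1) _ is_view_qual[OF ret2(4,3)]]) simp
      moreover have r: "r = rnd (L k i)"
        using False Suc.prems ret2 by simp
      moreover have "\<exists>v' r'. dec (L (Suc k) i) = Some (v', r') \<and> r' \<le> r"
        if "view_of (L k i) (rnd (L k i), 1) J = {Some v}" for v
        using ret2 that r dec_view[OF assms(1), of k] by (auto simp: step8_def Let_def)
      ultimately show ?thesis
        by blast
    qed (use False Suc.prems in simp_all)
  qed
qed

section \<open>Agreement and validity\<close>

lemma singleton_value_Some: "singleton_value U = Some v \<longleftrightarrow> U = {Some v}"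
  by (auto simp: singleton_value_def)

lemma Input_1_Some:
  assumes "i \<in> C" "Input k i (r, 1) (Some v)"
  shows "is_union (L k i) r {Some v}" "\<exists>j\<in>C. Input k j (r, 0) (Some v)"
proof -
  show "is_union (L k i) r {Some v}"
    using Input_1[OF assms] by (metis singleton_value_Some)
  with union_Input[OF assms(1)] show "\<exists>j\<in>C. Input k j (r, 0) (Some v)" by blast
qed

text \<open>Both unions are singletons and contain a common nonempty AUXSET, so they
  coincide.\<close>

lemma Input_1_agree:
  assumes "i \<in> C" "Input k i (r, 1) (Some v)" "i' \<in> C" "Input k' i' (r, 1) (Some v')"
  shows "v = v'"
  using union_common[OF assms(1) Input_1_Some(1)[OF assms(1,2)] assms(3) Input_1_Some(1)[OF assms(3,4)]]
  by (metis option.inject singleton_insert_inj_eq subset_singletonD)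

text \<open>Bottom results only from a union that is not a singleton; without bottom among the first
  inputs such a union contains both bits. Hence \<open>v\<close> is arbitrary.\<close>

lemma Input_1_None:
  assumes "i \<in> C" "Input k i (r, 1) None" "\<And>j. j \<in> C \<Longrightarrow> \<not> Input k j (r, 0) None"
  shows "\<exists>j\<in>C. Input k j (r, 0) (Some v)"
proof -
  obtain U where U: "is_union (L k i) r U" "singleton_value U = None"
    using Input_1[OF assms(1,2)] by metis
  have "None \<notin> U"
    using union_Input[OF assms(1) U(1)] assms(3) by blast
  moreover have "U \<noteq> {Some (\<not> v)}"
    using U(2) singleton_value_Some by (metis option.distinct(1))
  moreover obtain y where "y \<in> U"
    using union_nonempty[OF assms(1) U(1)] by blast
  ultimately have "Some v \<in> U"
  proof (rule_tac ccontr)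
    assume "Some v \<notin> U"
    have "x = Some (\<not> v)" if "x \<in> U" for x
      using that \<open>None \<notin> U\<close> \<open>Some v \<notin> U\<close> by (cases x) (auto, metis)
    with \<open>y \<in> U\<close> have "U = {Some (\<not> v)}" by blast
    with \<open>U \<noteq> {Some (\<not> v)}\<close> show False ..
  qed
  then show ?thesis
    using union_Input[OF assms(1) U(1)] by blast
qed

text \<open>By \<open>Input_1_agree\<close> a second view cannot contain both bits, so the final
  branch of \<open>step8\<close> is never taken.\<close>

lemma view_1_form:
  assumes "i \<in> C" "is_view (L k i) (r, 1) W"
  obtains v where "W = {Some v} \<or> W = {Some v, None} \<or> W = {None}"
proof -
  have "u = u'" if "Some u \<in> W" "Some u' \<in> W" for u u'
    using view_Input[OF assms that(1)] view_Input[OF assms that(2)] Input_1_agree by blast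
  moreover have "W \<noteq> {}"
    using view_inter[OF assms assms] by blast
  ultimately have "\<exists>v. W = {Some v} \<or> W = {Some v, None} \<or> W = {None}"
  proof (cases "\<exists>u. Some u \<in> W")
    case True
    then obtain u where u: "Some u \<in> W" ..
    have "x = None \<or> x = Some u" if "x \<in> W" for x
      using that u \<open>\<And>u u'. Some u \<in> W \<Longrightarrow> Some u' \<in> W \<Longrightarrow> u = u'\<close> by (cases x) auto
    with u have "W = {Some u} \<or> W = {Some u, None}" by blast
    then show ?thesis by blast
  next
    case False
    have "x = None" if "x \<in> W" for x
      using that False by (cases x) auto
    with \<open>W \<noteq> {}\<close> have "W = {None}" by blast
    then show ?thesis by blast
  qed
  with that show thesis by blast
qed

lemma est_step8:
  "est (step8 {Some v} b s) = Some v" "est (step8 {Some v, None} b s) = Some v"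
  "est (step8 {None} b s) = Some b"
proof -
  have "(THE u. {Some v, None} = {Some u, None}) = v"
    by (rule the_equality) (simp_all add: doubleton_eq_iff)
  then show "est (step8 {Some v, None} b s) = Some v"
    by (auto simp: step8_def)
qed (auto simp: step8_def Let_def)

lemma Input_0_not_None: "i \<in> C \<Longrightarrow> \<not> Input k i (r, 0) None"
proof (cases r)
  case 0
  then show "i \<in> C \<Longrightarrow> ?thesis" using Input_round by fastforce
next
  case (Suc r')
  show "\<not> Input k i (r, 0) None" if i: "i \<in> C"
  proof
    assume "Input k i (r, 0) None"
    then obtain W b s where W: "is_view (L k i) (r', 1) W" "None = est (step8 W b s)"
      using Input_0_next[OF i, of k r' None] Suc by auto
    obtain v where "W = {Some v} \<or> W = {Some v, None} \<or> W = {None}"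
      using view_1_form[OF i W(1)] .
    with W(2) est_step8 show False by (metis option.distinct(1))
  qed
qed

text \<open>The coin is consulted only if some non-faulty process saw both values in step (4), so it never
  introduces a value that was not already an input of the round.\<close>

lemma Input_0_prev:
  assumes "i \<in> C" "1 \<le> r" "Input k i (Suc r, 0) x"
  shows "\<exists>j\<in>C. Input k j (r, 0) x"
proof -
  obtain W b s where W: "is_view (L k i) (r, 1) W" "x = est (step8 W b s)"
    using Input_0_next[OF assms(1,3)] assms(2) by auto
  obtain v where v: "W = {Some v} \<or> W = {Some v, None} \<or> W = {None}"
    using view_1_form[OF assms(1) W(1)] .
  show ?thesis
  proof (cases "W = {None}")
    case True
    then obtain j where "j \<in> C" "Input k j (r, 1) None"
      using view_Input[OF assms(1) W(1)] by blast
    then show ?thesis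
      using Input_1_None Input_0_not_None True W(2) est_step8(3) by metis
  next
    case False
    with v have "Some v \<in> W" "x = Some v"
      using W(2) est_step8 by auto
    then show ?thesis
      using view_Input[OF assms(1) W(1)] Input_1_Some(2) by metis
  qed
qed

lemma Input_0_down:
  assumes "r \<le> r'" "1 \<le> r" "i \<in> C" "Input k i (r', 0) x"
  shows "\<exists>j\<in>C. Input k j (r, 0) x"
  using assms(1,3,4)
proof (induction r' arbitrary: i rule: dec_induct)
  case (step r')
  then show ?case using Input_0_prev assms(2) by (metis le_trans)
qed blast

lemma Input_0_proposed:
  assumes "i \<in> C" "Input k i (r, 0) x"
  shows "\<exists>j\<in>C. x = Some (inp j)"
proof -
  obtain j where j: "j \<in> C" "Input k j (1, 0) x"
    using Input_0_down[OF Input_round[OF assms] _ assms] by auto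
  have "x = Some (inp j)"
  proof -
    from Input_0_next[OF j(1), of k 0 x] j(2)
    consider "x = Some (inp j)" | W where "is_view (L k j) (0, 1) W" by auto
    then show ?thesis
    proof cases
      \<comment> \<open>A view of round 0 would be nonempty, and its elements would be inputs of
        round 0, whereas rounds start at 1.\<close>
      case 2
      then obtain y where "y \<in> W" using view_inter[OF j(1) 2 j(1) 2] by blast
      then show ?thesis
        using view_Input[OF j(1) 2] Input_round by fastforce
    qed
  qed
  with j show ?thesis by blast
qed

lemma validity:
  assumes "i \<in> C" "dec (L k i) = Some (v, r)"
  shows "\<exists>j\<in>C. Input k j (r, 0) (Some v)" "\<exists>j\<in>C. inp j = v"
proof -
  have "is_view (L k i) (r, 1) {Some v}"
    using dec_view[OF assms] by blast
  then show *: "\<exists>j\<in>C. Input k j (r, 0) (Some v)"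
    using view_Input[OF assms(1)] Input_1_Some(2) by blast
  show "\<exists>j\<in>C. inp j = v"
    using * Input_0_proposed by blast
qed

text \<open>Every other second view of the round meets \<open>{Some v}\<close>. It is therefore
  \<open>{Some v}\<close> or \<open>{Some v, None}\<close>, and both make the process adopt
  \<open>v\<close> without consulting the coin.\<close>

lemma view_1_locks:
  assumes "i \<in> C" "is_view (L k i) (r, 1) {Some v}" "1 \<le> r" "j \<in> C" "Input k' j (Suc r, 0) x"
  shows "x = Some v"
proof -
  obtain W b s where W: "is_view (L k' j) (r, 1) W" "x = est (step8 W b s)"
    using Input_0_next[OF assms(4,5)] assms(3) by auto
  obtain u where u: "W = {Some u} \<or> W = {Some u, None} \<or> W = {None}"
    using view_1_form[OF assms(4) W(1)] .
  have "Some v \<in> W"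
    using view_inter[OF assms(1,2,4) W(1)] by blast
  with u W(2) show ?thesis
    by (auto simp: est_step8)
qed

text \<open>The bit of the later decision was an input of round \<open>r'\<close>; descending with
  \<open>Input_0_down\<close> makes it an input of round \<open>Suc r\<close>, where the earlier
  decision has locked the other bit out.\<close>

lemma agreement_le:
  assumes "i \<in> C" "dec (L k i) = Some (x, r)" "j \<in> C" "dec (L k' j) = Some (y, r')" "r \<le> r'"
  shows "x = y"
proof -
  note i = dec_view[OF assms(1,2)] and j = dec_view[OF assms(3,4)]
  show ?thesis
  proof (cases "r = r'")
    case True
    then show ?thesis
      using view_inter[OF assms(1) _ assms(3), of k "(r, 1)" "{Some x}" k' "{Some y}"] i j by simp
  next
    case False
    obtain l where l: "l \<in> C" "Input k' l (r', 0) (Some y)"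
      using validity(1)[OF assms(3,4)] by blast
    then obtain l' where "l' \<in> C" "Input k' l' (Suc r, 0) (Some y)"
      using Input_0_down[of "Suc r" r' l k' "Some y"] False assms(5) by auto
    then have "Some y = Some x"
      using view_1_locks assms(1) i by blast
    then show ?thesis by simp
  qed
qed

lemma agreement:
  assumes "i \<in> C" "dec (L k i) = Some (x, r)" "j \<in> C" "dec (L k' j) = Some (y, r')"
  shows "x = y"
  using agreement_le[OF assms] agreement_le[OF assms(3,4,1,2)] nat_le_linear by metis

text \<open>A unanimous input is the only element of every union, hence the only input of the second
  SBV-Broadcast and the only element of its views; the coin has no influence.\<close>

lemma locked_decides:
  assumes locked: "\<And>k j x. j \<in> C \<Longrightarrow> Input k j (r, 0) x \<Longrightarrow> x = Some v"
    and "1 \<le> r" "i \<in> C" "r < rnd (L k i)"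
  shows "\<exists>v' r'. dec (L k i) = Some (v', r') \<and> r' \<le> r"
proof -
  have input_1: "x = Some v" if j: "j \<in> C" "Input k j (r, 1) x" for j x
  proof -
    obtain U where U: "is_union (L k j) r U" "x = singleton_value U"
      using Input_1[OF j] by blast
    have "U \<subseteq> {Some v}"
      using union_Input[OF j(1) U(1)] locked by blast
    then have "U = {Some v}"
      using union_nonempty[OF j(1) U(1)] by blast
    with U(2) singleton_value_Some show ?thesis by blast
  qed
  obtain W where W: "is_view (L k i) (r, 1) W"
    "\<forall>v. W = {Some v} \<longrightarrow> (\<exists>v' r'. dec (L k i) = Some (v', r') \<and> r' \<le> r)"
    using round_finished[OF assms(3,2,4)] by blast
  have "W = {Some v}"
    using view_Input[OF assms(3) W(1)] input_1 view_inter[OF assms(3) W(1) assms(3) W(1)] by blast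
  with W(2) show ?thesis by blast
qed


section \<open>Revelation of the coins\<close>

lemma coins_Suc:
  "coins (c (Suc k)) r =
    (if \<exists>i. valid_local n t F i (a k) (c k) \<and> pc (L k i) = WaitAux 1 \<and> rnd (L k i) = r
     then Some (w r) else coins (c k) r)"
proof (cases "a k")
  case (AuxStep j v)
  then show ?thesis
    by (auto simp: c_Suc step_def valid_local_def auxok_def Let_def split: phase.splits)
next
  case (Ret j J b)
  then show ?thesis
    by (auto simp: c_Suc step_def valid_local_def Let_def split: phase.splits nat.splits)
qed (auto simp: c_Suc step_def valid_local_def Let_def split: prod.splits)

lemma coins_0: "coins (c 0) r = None"
  by (simp add: c_0 init_def)

lemma coins_hidden_before: "k \<le> k' \<Longrightarrow> coins (c k') r = None \<Longrightarrow> coins (c k) r = None"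
proof (induction k' rule: dec_induct)
  case (step k')
  then show ?case by (simp add: coins_Suc split: if_splits)
qed

lemma valid_local_correct: "valid_local n t F i (a k) (c k) \<Longrightarrow> i \<in> C"
  by (simp add: valid_local_def)

text \<open>Round 0 has to be excluded: all processes are beyond it from the start, yet no coin with
  index 0 is ever revealed.\<close>

lemma coin_revealed_iff: "coins (c k) r \<noteq> None \<and> 1 \<le> r \<longleftrightarrow> (\<exists>i\<in>C. r < rnd (L k i)) \<and> 1 \<le> r"
proof (induction k)
  case 0
  then show ?case by (auto simp: c_0 init_def)
next
  case (Suc k)
  have "r < rnd (L (Suc k) i) \<longleftrightarrow> r < rnd (L k i) \<or>
    (valid_local n t F i (a k) (c k) \<and> pc (L k i) = WaitAux 1 \<and> rnd (L k i) = r)" if i: "i \<in> C" for i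
  proof
    assume *: "r < rnd (L (Suc k) i)"
    show "r < rnd (L k i) \<or> (valid_local n t F i (a k) (c k) \<and> pc (L k i) = WaitAux 1 \<and> rnd (L k i) = r)"
    proof (rule ccontr)
      assume **: "\<not> ?thesis"
      have "valid_local n t F i (a k) (c k)"
        using * ** idle_local(2)[OF i, of k] by auto
      obtain Ms where "move k i (L k i) Ms (L (Suc k) i)"
        using step_move[OF i] .
      then show False
        using \<open>valid_local n t F i (a k) (c k)\<close> * ** by cases auto
    qed
  next
    assume "r < rnd (L k i) \<or> (valid_local n t F i (a k) (c k) \<and> pc (L k i) = WaitAux 1 \<and> rnd (L k i) = r)"
    then show "r < rnd (L (Suc k) i)"
    proof
      assume "r < rnd (L k i)"
      then show ?thesis using mono_rnd[OF i, of k "Suc k"] by simp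
    next
      assume *: "valid_local n t F i (a k) (c k) \<and> pc (L k i) = WaitAux 1 \<and> rnd (L k i) = r"
      then have "stage (L (Suc k) i) = 5 * (r + 1)"
        using stage_Suc[OF i, of k] stage_cases(5)[OF i, of k r] by simp
      then show ?thesis
        using stage_cases(1)[OF i, of "Suc k" "r + 1"] by simp
    qed
  qed
  then show ?case
    using Suc.IH valid_local_correct by (auto simp: coins_Suc)
qed

text \<open>A process that has passed round \<open>r'\<close> has also passed round
  \<open>r\<close>, so coins are revealed in the order of rounds.\<close>

lemma coin_hidden_above: "1 \<le> r \<Longrightarrow> r \<le> r' \<Longrightarrow> coins (c k) r = None \<Longrightarrow> coins (c k) r' = None"
  using coin_revealed_iff[of k r] coin_revealed_iff[of k r'] by force

text \<open>The bit that the coin has to hit in round \<open>r\<close>.  If no singleton AUXSET message was sent before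
  the coin is revealed, then no bit survives as an input of the second SBV-Broadcast, every
  non-faulty process adopts the coin, and the default \<open>False\<close> is as good as \<open>True\<close>.\<close>

definition favoured :: "nat \<Rightarrow> bool" where
  "favoured r \<longleftrightarrow> (\<exists>k i j. i \<in> C \<and> coins (c k) r = None \<and> (i, j, AUXSET r {Some True}) \<in> net (c k))"

lemma Input_1_favoured:
  assumes "1 \<le> r" "coins (c k') r \<noteq> None" "i \<in> C" "Input k i (r, 1) (Some v)"
  shows "v = favoured r"
proof -
  \<comment> \<open>\<open>k0\<close> is the last configuration in which the coin is hidden, so the
    step taken there is that of the revealing process \<open>p\<close>.\<close>
  obtain k0 where k0: "coins (c k0) r = None" "coins (c (Suc k0)) r \<noteq> None"
  proof (rule ccontr)
    assume "\<not> thesis"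
    with that have "coins (c k) r = None \<Longrightarrow> coins (c (Suc k)) r = None" for k by blast
    then have "coins (c k') r = None" by (induction k') (simp_all add: coins_0)
    with assms(2) show False by simp
  qed
  then obtain p where p: "p \<in> C" "pc (L k0 p) = WaitAux 1" "rnd (L k0 p) = r"
    using valid_local_correct by (auto simp: coins_Suc split: if_splits)
  \<comment> \<open>At \<open>WaitAux 1\<close> the process \<open>p\<close> has step (4) behind it,
    so its union was formed while the coin was hidden.\<close>
  then have "Input k0 p (r, 1) (est (L k0 p))"
    by (intro Input_now) (simp_all add: tag_of_def)
  then obtain U where U: "is_union (L k0 p) r U"
    using Input_1 p(1) by blast
  obtain j S where j: "j \<in> C" "S \<noteq> {}" "S \<subseteq> {Some v}" "sent k0 j (AUXSET r S)"
    using union_common[OF p(1) U assms(3) Input_1_Some(1)[OF assms(3,4)]] .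
  then have S: "S = {Some v}" by blast
  from j(4) obtain k1 l where k1: "k1 \<le> k0" "(j, l, AUXSET r S) \<in> net (c k1)"
    unfolding sent_def by blast
  have "coins (c k1) r = None"
    using coins_hidden_before[OF k1(1) k0(1)] .
  show ?thesis
  proof (cases v)
    case True
    with S have "S = {Some True}" by simp
    then have "favoured r"
      using k1 j(1) \<open>coins (c k1) r = None\<close> unfolding favoured_def by blast
    with True show ?thesis by simp
  next
    case False
    \<comment> \<open>Otherwise \<open>{Some True}\<close> and \<open>{Some False}\<close> would
      both be views of the first SBV-Broadcast of round \<open>r\<close>, against
      \<open>view_inter\<close>.\<close>
    have "\<not> favoured r"
    proof
      assume "favoured r"
      then obtain k2 q where q: "q \<in> C" "sent k2 q (AUXSET r {Some True})"
        unfolding favoured_def using sent_netI by blast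
      have "{Some True} \<inter> {Some v} \<noteq> {}"
        using view_inter[OF q(1) conjunct2[OF sent_auxset[OF q]] j(1) conjunct2[OF sent_auxset[OF j(1,4)]]] S
        by simp
      with False show False by simp
    qed
    with False show ?thesis by simp
  qed
qed

lemma lucky_coin_locks:
  assumes "1 \<le> r" "w r = CAgree (favoured r)" "i \<in> C" "Input k i (Suc r, 0) x"
  shows "x = Some (favoured r)"
proof -
  obtain W b s where W: "is_view (L k i) (r, 1) W" "x = est (step8 W b s)" "\<forall>y. w r = CAgree y \<longrightarrow> b = y"
    using Input_0_next[OF assms(3,4)] assms(1) by auto
  obtain v where v: "W = {Some v} \<or> W = {Some v, None} \<or> W = {None}"
    using view_1_form[OF assms(3) W(1)] .
  \<comment> \<open>An input of round \<open>Suc r\<close> shows that a process has left round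
    \<open>r\<close>, hence that the coin was revealed, as \<open>Input_1_favoured\<close>
    requires.\<close>
  obtain k' where "est (L k' i) = x" "tag_of (L k' i) = (Suc r, 0)"
    using assms(4) unfolding Input_def by blast
  then have "r < rnd (L k' i)"
    by (simp add: tag_of_def)
  then have "coins (c k') r \<noteq> None"
    using coin_revealed_iff[of k' r] assms(1,3) by blast
  have hit: "v' = favoured r" if v': "Some v' \<in> W" for v'
  proof -
    obtain j where "j \<in> C" "Input k j (r, 1) (Some v')"
      using view_Input[OF assms(3) W(1) v'] by blast
    then show ?thesis
      using Input_1_favoured[OF assms(1) \<open>coins (c k') r \<noteq> None\<close>] by blast
  qed
  show ?thesis
    using v W(2,3) assms(2) hit[of v] by (auto simp: est_step8)
qed

section \<open>Messages that a process must have sent\<close>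

text \<open>The relay is part of the reception itself, so no scheduling is involved.\<close>

lemma relayed:
  "i \<in> C \<Longrightarrow> t < card (bvrecv (L k i) T x) \<Longrightarrow> bvsent (L k i) T x"
proof (induction k arbitrary: T x)
  case (Suc k)
  obtain Ms where "move k i (L k i) Ms (L (Suc k) i)"
    using step_move[OF Suc.prems(1)] .
  then show ?case
    using Suc by cases (auto split: if_splits)
qed (simp add: c_0 init_def)

lemma Input_sent:
  assumes "i \<in> C" "Input k i T x"
  shows "sent k i (BVAL T x)"
  using assms(2)
proof (induction k)
  case 0
  then show ?case using assms(1) by (simp add: Input_init sent_0)
next
  case (Suc k)
  have old: ?case if "Input k i T x"
    using Suc.IH[OF that] sent_mono le_SucI[OF le_refl] by blast
  show ?case
  proof (cases "est (L (Suc k) i) = x \<and> tag_of (L (Suc k) i) = T")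
    case False
    then show ?thesis using Suc.prems[unfolded Input_step] old by blast
  next
    case True
    obtain Ms where mv: "move k i (L k i) Ms (L (Suc k) i)"
      and Ms: "\<And>m. sent (Suc k) i m \<longleftrightarrow> sent k i m \<or> m \<in> Ms"
      using sent_step[OF assms(1), of k] by metis
    from mv show ?thesis
    proof cases
      case (ret1 J e)
      with True Ms show ?thesis by (auto simp: tag_of_def)
    next
      case (ret2 J s' b)
      with True Ms show ?thesis by (auto simp: tag_of_def)
    qed ((rule old, rule Input_now; use True in \<open>auto simp: tag_of_def\<close>)+)
  qed
qed

text \<open>Counterpart of \<open>sent_aux\<close>: stage \<open>5 * r + 3 * q\<close> is left only
  by broadcasting AUX. Liveness infers from the progress of a process what it has sent.\<close>

lemma aux_sent:
  assumes "i \<in> C" "1 \<le> r" "5 * r + 3 * q < stage (L k i)" "q \<le> 1"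
  shows "\<exists>v. sent k i (AUX (r, q) v)"
  using assms(3)
proof (induction k)
  case 0
  then show ?case using assms(2) by (simp add: stage_0)
next
  case (Suc k)
  obtain Ms where mv: "move k i (L k i) Ms (L (Suc k) i)"
    and Ms: "\<And>m. sent (Suc k) i m \<longleftrightarrow> sent k i m \<or> m \<in> Ms"
    using sent_step[OF assms(1), of k] by metis
  show ?case
  proof (cases "5 * r + 3 * q < stage (L k i)")
    case True
    then show ?thesis using Suc.IH Ms by blast
  next
    case False
    then have st: "stage (L k i) = 5 * r + 3 * q" "stage (L (Suc k) i) \<noteq> stage (L k i)"
      using Suc.prems stage_Suc[OF assms(1), of k] by (auto split: if_splits)
    then have pc: "pc (L k i) = WaitBin q" "rnd (L k i) = r"
      using stage_cases(1,4)[OF assms(1), of k r] assms(4) by (cases q; simp)+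
    from mv show ?thesis
      by cases (use st(2) pc Ms in \<open>auto simp: stage_def\<close>)
  qed
qed

lemma auxset_sent:
  assumes "i \<in> C" "1 \<le> r" "5 * r + 1 < stage (L k i)"
  shows "\<exists>S. sent k i (AUXSET r S)"
  using assms(3)
proof (induction k)
  case 0
  then show ?case using assms(2) by (simp add: stage_0)
next
  case (Suc k)
  obtain Ms where mv: "move k i (L k i) Ms (L (Suc k) i)"
    and Ms: "\<And>m. sent (Suc k) i m \<longleftrightarrow> sent k i m \<or> m \<in> Ms"
    using sent_step[OF assms(1), of k] by metis
  show ?case
  proof (cases "5 * r + 1 < stage (L k i)")
    case True
    then show ?thesis using Suc.IH Ms by blast
  next
    case False
    then have st: "stage (L k i) = 5 * r + 1" "stage (L (Suc k) i) \<noteq> stage (L k i)"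
      using Suc.prems stage_Suc[OF assms(1), of k] by (auto split: if_splits)
    then have pc: "pc (L k i) = WaitAux 0" "rnd (L k i) = r"
      using stage_cases(2)[OF assms(1), of k r] by simp_all
    from mv show ?thesis
      by cases (use st(2) pc Ms in \<open>auto simp: stage_def\<close>)
  qed
qed

end

section \<open>Progress in fair executions\<close>

locale fair_execution = execution +
  assumes delivery: "i \<in> C \<Longrightarrow> j \<in> C \<Longrightarrow> (i, j, m) \<in> net (c k) \<Longrightarrow>
      \<exists>k'\<ge>k. a k' = Deliver i j m \<and> (i, j, m) \<in> net (c k')"
    and scheduling: "i \<in> C \<Longrightarrow> local_enabled n t F i (c k) \<Longrightarrow> \<exists>k'\<ge>k. valid_local n t F i (a k') (c k')"
begin

lemma delivered:
  assumes "i \<in> C" "j \<in> C" "sent k i m"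
  shows "\<exists>k'. L (Suc k') j = fst (recv n t j i m (L k' j))"
proof -
  obtain k0 where k0: "(i, j, m) \<in> net (c k0)"
    using sent_all[OF assms(1,3)] C_less[OF assms(2)] by blast
  obtain k' where "a k' = Deliver i j m" "(i, j, m) \<in> net (c k')"
    using delivery[OF assms(1,2) k0] by blast
  then have "L (Suc k') j = fst (recv n t j i m (L k' j))"
    using assms(2) by (simp add: c_Suc step_def split: prod.splits)
  then show ?thesis ..
qed

lemma ev_bvrecv:
  assumes "i \<in> C" "j \<in> C" "sent k i (BVAL T x)"
  shows "\<forall>\<^sub>F k in sequentially. i \<in> bvrecv (L k j) T x"
proof -
  obtain k' where "L (Suc k') j = fst (recv n t j i (BVAL T x) (L k' j))"
    using delivered[OF assms] ..
  then have "i \<in> bvrecv (L (Suc k') j) T x"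
    by (simp add: Let_def)
  then show ?thesis
    using mono_bvrecv[OF assms(2)] unfolding eventually_sequentially by blast
qed

lemma ev_auxrecv:
  assumes "i \<in> C" "j \<in> C" "sent k i (AUX T v)"
  shows "\<forall>\<^sub>F k in sequentially. auxrecv (L k j) T i = Some v"
proof -
  obtain k' where "L (Suc k') j = fst (recv n t j i (AUX T v) (L k' j))"
    using delivered[OF assms] ..
  \<comment> \<open>The slot may already have been filled before this delivery;
    \<open>aux_unique\<close> shows that its content is the same.\<close>
  then obtain v' where v': "auxrecv (L (Suc k') j) T i = Some v'"
    by (cases "auxrecv (L k' j) T i") auto
  have "sent (max k (Suc k')) i (AUX T v)" "sent (max k (Suc k')) i (AUX T v')"
    using assms(3) auxrecv_sent[OF assms(2,1) v'] sent_mono by (metis max.cobounded1, metis max.cobounded2)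
  then have "v' = v"
    using aux_unique[OF assms(1)] by blast
  then show ?thesis
    using v' auxrecv_stable[OF assms(2)] unfolding eventually_sequentially by blast
qed

lemma ev_auxsrecv:
  assumes "i \<in> C" "j \<in> C" "sent k i (AUXSET r S)"
  shows "\<forall>\<^sub>F k in sequentially. auxsrecv (L k j) r i = Some S"
proof -
  obtain k' where "L (Suc k') j = fst (recv n t j i (AUXSET r S) (L k' j))"
    using delivered[OF assms] ..
  then obtain S' where S': "auxsrecv (L (Suc k') j) r i = Some S'"
    by (cases "auxsrecv (L k' j) r i") auto
  have "S' = S"
    using auxset_unique[OF assms(1) auxsrecv_sent[OF assms(2,1) S'] assms(3)] .
  then show ?thesis
    using S' auxsrecv_stable[OF assms(2)] unfolding eventually_sequentially by blast
qed

text \<open>Two rounds of amplification: \<open>t + 1\<close> correct senders make every correct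
  process relay, and the at least \<open>n - t\<close> relays exceed the threshold
  \<open>2 * t + 1\<close>.\<close>

lemma ev_bin:
  assumes "J \<subseteq> C" "t < card J" "\<And>j. j \<in> J \<Longrightarrow> \<exists>k. sent k j (BVAL T x)"
  shows "\<forall>\<^sub>F k in sequentially. \<forall>i\<in>C. x \<in> bin t (L k i) T"
proof -
  have finJ: "finite J"
    using assms(1) by (rule finite_subset) simp
  have "\<exists>k. sent k i (BVAL T x)" if i: "i \<in> C" for i
  proof -
    have "\<forall>\<^sub>F k in sequentially. \<forall>j\<in>J. j \<in> bvrecv (L k i) T x"
      using assms(1,3) ev_bvrecv i by (intro eventually_ball_finite finJ) blast
    then obtain k where "J \<subseteq> bvrecv (L k i) T x"
      unfolding eventually_sequentially by blast
    then have "t < card (bvrecv (L k i) T x)"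
      using assms(2) card_mono[OF finite_bvrecv[OF i]] by (meson less_le_trans)
    then show ?thesis
      using relayed[OF i] bvsent_sent[OF i] by blast
  qed
  then have "\<forall>\<^sub>F k in sequentially. \<forall>i\<in>C. \<forall>j\<in>C. j \<in> bvrecv (L k i) T x"
    using ev_bvrecv by (intro eventually_ball_finite finite_C ballI) blast
  then show ?thesis
  proof (rule eventually_mono)
    fix k assume *: "\<forall>i\<in>C. \<forall>j\<in>C. j \<in> bvrecv (L k i) T x"
    have "2 * t + 1 \<le> card (bvrecv (L k i) T x)" if "i \<in> C" for i
    proof -
      have "card C \<le> card (bvrecv (L k i) T x)"
        using * that by (intro card_mono finite_bvrecv) auto
      with card_C resilience show ?thesis by linarith
    qed
    then show "\<forall>i\<in>C. x \<in> bin t (L k i) T"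
      by (simp add: bin_def)
  qed
qed

lemma ev_bin_total:
  assumes "i \<in> C" "x \<in> bin t (L k i) T"
  shows "\<forall>\<^sub>F k in sequentially. \<forall>i\<in>C. x \<in> bin t (L k i) T"
proof (rule ev_bin)
  let ?J = "bvrecv (L k i) T x - F"
  show sub: "?J \<subseteq> C"
    using bvrecv_subset[OF assms(1), of k T x] by (auto simp: correct_def)
  \<comment> \<open>Of the \<open>2 * t + 1\<close> senders at most \<open>t\<close> are Byzantine,
    which leaves the \<open>t + 1\<close> correct ones that \<open>ev_bin\<close> needs.\<close>
  have "card (bvrecv (L k i) T x) - card F \<le> card ?J"
    by (rule diff_card_le_card_Diff) simp
  then show "t < card ?J"
    using assms(2) card_F by (simp add: bin_def)
  show "\<exists>k. sent k j (BVAL T x)" if "j \<in> ?J" for j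
    using bvrecv_sent[OF assms(1), of j k T x] that sub by blast
qed

text \<open>Pigeonhole: at least \<open>2 * t + 1\<close> correct processes distributed over two
  values give one value \<open>t + 1\<close> supporters. The second SBV-Broadcast satisfies this
  only because a single bit competes with bottom.\<close>

lemma ev_bin_nonempty:
  assumes "\<And>j. j \<in> C \<Longrightarrow> \<exists>k x. Input k j T x \<and> x \<in> {u, v}"
  shows "\<exists>x. \<forall>\<^sub>F k in sequentially. \<forall>i\<in>C. x \<in> bin t (L k i) T"
proof -
  define J where "J x = {j \<in> C. \<exists>k. sent k j (BVAL T x)}" for x
  have "C \<subseteq> J u \<union> J v"
    using assms Input_sent unfolding J_def by blast
  then have "card C \<le> card (J u \<union> J v)"
    by (intro card_mono) (auto simp: J_def)
  also have "\<dots> \<le> card (J u) + card (J v)"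
    by (rule card_Un_le)
  finally have "t < card (J u) \<or> t < card (J v)"
    using card_C resilience by linarith
  then obtain x where "t < card (J x)" by blast
  then have "\<forall>\<^sub>F k in sequentially. \<forall>i\<in>C. x \<in> bin t (L k i) T"
    by (intro ev_bin[of "J x"]) (auto simp: J_def)
  then show ?thesis ..
qed

lemma ev_stage_progress:
  assumes "i \<in> C" "\<forall>\<^sub>F k in sequentially. q \<le> stage (L k i)"
    "\<forall>\<^sub>F k in sequentially. stage (L k i) = q \<longrightarrow> local_enabled n t F i (c k)"
  shows "\<forall>\<^sub>F k in sequentially. Suc q \<le> stage (L k i)"
proof -
  obtain k where k: "q \<le> stage (L k i)" "stage (L k i) = q \<longrightarrow> local_enabled n t F i (c k)"
    using eventually_conj[OF assms(2,3)] unfolding eventually_sequentially by blast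
  have "\<exists>k'. Suc q \<le> stage (L k' i)"
  proof (cases "stage (L k i) = q")
    case True
    then obtain k' where "k' \<ge> k" "valid_local n t F i (a k') (c k')"
      using k(2) scheduling[OF assms(1)] by blast
    then have "Suc q \<le> stage (L (Suc k') i)"
      using True mono_stage[OF assms(1), of k k'] stage_Suc[OF assms(1), of k'] by simp
    then show ?thesis ..
  next
    case False
    with k(1) have "Suc q \<le> stage (L k i)" by simp
    then show ?thesis ..
  qed
  then show ?thesis
    using mono_stage[OF assms(1)] le_trans unfolding eventually_sequentially by blast
qed

lemma ev_enabled_WaitBin:
  assumes "i \<in> C" "\<forall>\<^sub>F k in sequentially. x \<in> bin t (L k i) (r, q)"
  shows "\<forall>\<^sub>F k in sequentially. rnd (L k i) = r \<and> pc (L k i) = WaitBin q \<longrightarrow> local_enabled n t F i (c k)"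
  using assms(2)
proof (rule eventually_mono, intro impI)
  fix k assume "x \<in> bin t (L k i) (r, q)" "rnd (L k i) = r \<and> pc (L k i) = WaitBin q"
  then have "valid_local n t F i (AuxStep i x) (c k)"
    using assms(1) by (simp add: valid_local_def auxok_def)
  then show "local_enabled n t F i (c k)"
    unfolding local_enabled_def by blast
qed

lemma ev_enabled_WaitAux:
  assumes "i \<in> C" "\<And>j. j \<in> C \<Longrightarrow> \<exists>k v. sent k j (AUX (r, q) v)"
  shows "\<forall>\<^sub>F k in sequentially. rnd (L k i) = r \<and> pc (L k i) = WaitAux q \<longrightarrow> local_enabled n t F i (c k)"
proof -
  have "\<forall>\<^sub>F k in sequentially. \<exists>v. auxrecv (L k i) (r, q) j = Some v \<and> v \<in> bin t (L k i) (r, q)"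
    if j: "j \<in> C" for j
  proof -
    obtain k v where v: "sent k j (AUX (r, q) v)"
      using assms(2)[OF j] by blast
    have "\<forall>\<^sub>F k in sequentially. \<forall>i\<in>C. v \<in> bin t (L k i) (r, q)"
      using ev_bin_total[OF j] sent_aux[OF j v] by blast
    with ev_auxrecv[OF j assms(1) v] show ?thesis
      by eventually_elim (use assms(1) in blast)
  qed
  then have "\<forall>\<^sub>F k in sequentially. \<forall>j\<in>C. \<exists>v. auxrecv (L k i) (r, q) j = Some v \<and> v \<in> bin t (L k i) (r, q)"
    by (intro eventually_ball_finite finite_C ballI)
  then show ?thesis
  proof (rule eventually_mono, intro impI)
    fix k assume "\<forall>j\<in>C. \<exists>v. auxrecv (L k i) (r, q) j = Some v \<and> v \<in> bin t (L k i) (r, q)"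
      "rnd (L k i) = r \<and> pc (L k i) = WaitAux q"
    \<comment> \<open>Byzantine processes may stay silent, so the quorum is the set of correct
      processes; the bit \<open>True\<close> is arbitrary.\<close>
    then have "valid_local n t F i (Ret i C True) (c k)"
      using assms(1) card_C C_less by (auto simp: valid_local_def qual_def)
    then show "local_enabled n t F i (c k)"
      unfolding local_enabled_def by blast
  qed
qed

lemma ev_enabled_WaitAuxSet:
  assumes "i \<in> C" "\<And>j. j \<in> C \<Longrightarrow> \<exists>k S. sent k j (AUXSET r S)"
  shows "\<forall>\<^sub>F k in sequentially. rnd (L k i) = r \<and> pc (L k i) = WaitAuxSet \<longrightarrow> local_enabled n t F i (c k)"
proof -
  have "\<forall>\<^sub>F k in sequentially. \<exists>S. auxsrecv (L k i) r j = Some S \<and> S \<subseteq> bin t (L k i) (r, 0)"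
    if j: "j \<in> C" for j
  proof -
    obtain k S where S: "sent k j (AUXSET r S)"
      using assms(2)[OF j] by blast
    have "S \<subseteq> bin t (L k j) (r, 0)"
      using sent_auxset[OF j S] is_view_subset_bin by blast
    then have "\<forall>\<^sub>F k in sequentially. \<forall>x\<in>S. \<forall>i\<in>C. x \<in> bin t (L k i) (r, 0)"
      by (intro eventually_ball_finite[of S] ballI ev_bin_total[OF j]) auto
    with ev_auxsrecv[OF j assms(1) S] show ?thesis
      by eventually_elim (use assms(1) in \<open>simp add: subset_iff\<close>)
  qed
  then have "\<forall>\<^sub>F k in sequentially. \<forall>j\<in>C. \<exists>S. auxsrecv (L k i) r j = Some S \<and> S \<subseteq> bin t (L k i) (r, 0)"
    by (intro eventually_ball_finite finite_C ballI)
  then show ?thesis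
  proof (rule eventually_mono, intro impI)
    fix k assume "\<forall>j\<in>C. \<exists>S. auxsrecv (L k i) r j = Some S \<and> S \<subseteq> bin t (L k i) (r, 0)"
      "rnd (L k i) = r \<and> pc (L k i) = WaitAuxSet"
    then have "valid_local n t F i (Ret i C True) (c k)"
      using assms(1) card_C C_less by (auto simp: valid_local_def qual_def)
    then show "local_enabled n t F i (c k)"
      unfolding local_enabled_def by blast
  qed
qed

text \<open>A stage acts as a barrier: once all correct processes have reached it, they have sent
  everything that the wait at this stage depends on, and with fair delivery the wait ends.\<close>

lemma ev_stage_enabled:
  assumes reach: "\<And>j. j \<in> C \<Longrightarrow> \<forall>\<^sub>F k in sequentially. q \<le> stage (L k j)" and "5 \<le> q" "i \<in> C"
  shows "\<forall>\<^sub>F k in sequentially. stage (L k i) = q \<longrightarrow> local_enabled n t F i (c k)"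
proof -
  define r where "r = q div 5"
  have "1 \<le> r" using assms(2) by (simp add: r_def)
  have reached: "\<exists>k. q \<le> stage (L k j)" if "j \<in> C" for j
    using reach[OF that] unfolding eventually_sequentially by blast
  have attained: "\<exists>k. stage (L k j) = q" if "j \<in> C" for j
    using reached[OF that] stage_attained[OF that assms(2)] by blast
  have "q = 5 * r + q mod 5" "q mod 5 < 5"
    by (simp_all add: r_def)
  then consider "q = 5 * r" | "q = 5 * r + 1" | "q = 5 * r + 2" | "q = 5 * r + 3" | "q = 5 * r + 4"
    by linarith
  then show ?thesis
  proof cases
    case 1
    have "\<exists>k x. Input k j (r, 0) x \<and> x \<in> {Some True, Some False}" if j: "j \<in> C" for j
    proof -
      obtain k where "stage (L k j) = q" using attained[OF j] ..
      then have "Input k j (r, 0) (est (L k j))"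
        using 1 stage_cases(1)[OF j] by (intro Input_now) (auto simp: tag_of_def)
      moreover from this obtain j' where "est (L k j) = Some (inp j')"
        using Input_0_proposed[OF j] by blast
      ultimately show ?thesis
        by (intro exI[of _ k] exI[of _ "est (L k j)"]) auto
    qed
    then obtain x where "\<forall>\<^sub>F k in sequentially. \<forall>i\<in>C. x \<in> bin t (L k i) (r, 0)"
      using ev_bin_nonempty by blast
    then have "\<forall>\<^sub>F k in sequentially. x \<in> bin t (L k i) (r, 0)"
      by eventually_elim (use assms(3) in blast)
    from ev_enabled_WaitBin[OF assms(3) this] show ?thesis
      using 1 stage_cases(1)[OF assms(3)] by simp
  next
    case 2
    have "\<exists>k v. sent k j (AUX (r, 0) v)" if j: "j \<in> C" for j
    proof -
      obtain k where "q \<le> stage (L k j)" using reached[OF j] ..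
      then show ?thesis
        using aux_sent[OF j \<open>1 \<le> r\<close>, of 0 k] 2 by auto
    qed
    from ev_enabled_WaitAux[OF assms(3) this] show ?thesis
      using 2 stage_cases(2)[OF assms(3)] by simp
  next
    case 3
    have "\<exists>k S. sent k j (AUXSET r S)" if j: "j \<in> C" for j
    proof -
      obtain k where "q \<le> stage (L k j)" using reached[OF j] ..
      then show ?thesis
        using auxset_sent[OF j \<open>1 \<le> r\<close>, of k] 3 by auto
    qed
    from ev_enabled_WaitAuxSet[OF assms(3) this] show ?thesis
      using 3 stage_cases(3)[OF assms(3)] by simp
  next
    case 4
    have inp: "\<exists>k. Input k j (r, 1) (est (L k j))" if j: "j \<in> C" for j
    proof -
      obtain k where "stage (L k j) = q" using attained[OF j] ..
      then have "Input k j (r, 1) (est (L k j))"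
        using 4 stage_cases(4)[OF j] by (intro Input_now) (auto simp: tag_of_def)
      then show ?thesis ..
    qed
    \<comment> \<open>If no bit is ever an input here, any \<open>v\<close> will do.\<close>
    obtain v where v: "\<And>k j u. j \<in> C \<Longrightarrow> Input k j (r, 1) (Some u) \<Longrightarrow> u = v"
      using Input_1_agree by metis
    have "\<exists>k x. Input k j (r, 1) x \<and> x \<in> {Some v, None}" if j: "j \<in> C" for j
    proof -
      obtain k where k: "Input k j (r, 1) (est (L k j))" using inp[OF j] ..
      then have "est (L k j) \<in> {Some v, None}"
        using v[OF j, of k] by (cases "est (L k j)") auto
      with k show ?thesis by blast
    qed
    then obtain x where "\<forall>\<^sub>F k in sequentially. \<forall>i\<in>C. x \<in> bin t (L k i) (r, 1)"
      using ev_bin_nonempty by blast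
    then have "\<forall>\<^sub>F k in sequentially. x \<in> bin t (L k i) (r, 1)"
      by eventually_elim (use assms(3) in blast)
    from ev_enabled_WaitBin[OF assms(3) this] show ?thesis
      using 4 stage_cases(4)[OF assms(3)] by simp
  next
    case 5
    have "\<exists>k v. sent k j (AUX (r, 1) v)" if j: "j \<in> C" for j
    proof -
      obtain k where "q \<le> stage (L k j)" using reached[OF j] ..
      then show ?thesis
        using aux_sent[OF j \<open>1 \<le> r\<close>, of 1 k] 5 by auto
    qed
    from ev_enabled_WaitAux[OF assms(3) this] show ?thesis
      using 5 stage_cases(5)[OF assms(3)] by simp
  qed
qed

lemma ev_stage: "i \<in> C \<Longrightarrow> \<forall>\<^sub>F k in sequentially. q \<le> stage (L k i)"
proof (induction q arbitrary: i)
  case (Suc q)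
  show ?case
  proof (cases "5 \<le> q")
    case True
    then show ?thesis
      using ev_stage_progress[OF Suc.prems] ev_stage_enabled Suc by blast
  next
    case False
    then have "Suc q \<le> stage (L k i)" for k
      using mono_stage[OF Suc.prems, of 0 k] by (simp add: stage_0)
    then show ?thesis by simp
  qed
qed simp

lemma lucky_coin_decides:
  assumes "1 \<le> r" "w r = CAgree (favoured r)"
  shows "\<exists>k. \<forall>i\<in>C. \<exists>v r'. dec (L k i) = Some (v, r') \<and> r' \<le> Suc r"
proof -
  \<comment> \<open>Stage \<open>5 * (r + 2)\<close> is the start of round \<open>r + 2\<close>, so
    round \<open>Suc r\<close>, in which the locked value gets decided, is complete.\<close>
  have "\<forall>\<^sub>F k in sequentially. \<forall>i\<in>C. 5 * (r + 2) \<le> stage (L k i)"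
    using ev_stage by (intro eventually_ball_finite finite_C ballI)
  then obtain k where k: "\<forall>i\<in>C. 5 * (r + 2) \<le> stage (L k i)"
    unfolding eventually_sequentially by blast
  have "\<exists>v r'. dec (L k i) = Some (v, r') \<and> r' \<le> Suc r" if i: "i \<in> C" for i
  proof (rule locked_decides[OF lucky_coin_locks[OF assms]])
    have "5 * (r + 2) div 5 \<le> stage (L k i) div 5"
      using k i by (intro div_le_mono) blast
    then show "Suc r < rnd (L k i)"
      using rnd_stage[OF i] by simp
  qed (use i in simp_all)
  then show ?thesis by blast
qed

end


section \<open>The coin space\<close>

lemma execution_exec:
  assumes "3 * t < n" "F \<subseteq> {0..<n}" "card F \<le> t"
  shows "execution n t F inp \<omega> (exec n t F inp \<sigma> \<omega>) (action n t F inp \<sigma> \<omega>)"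
  using assms by unfold_locales (simp_all add: exec_def action_def)

lemma fair_execution_exec:
  assumes "3 * t < n" "F \<subseteq> {0..<n}" "card F \<le> t" "admissible n t F inp \<sigma>"
  shows "fair_execution n t F inp \<omega> (exec n t F inp \<sigma> \<omega>) (action n t F inp \<sigma> \<omega>)"
proof -
  have "fair n t F inp \<sigma> \<omega>"
    using assms(4) by (simp add: admissible_def)
  then show ?thesis
    using execution_exec[OF assms(1-3)] unfolding fair_execution_def fair_execution_axioms_def fair_def by blast
qed

lemma step_cong_coin:
  assumes "\<And>i. valid_local n t F i a c \<Longrightarrow> pc (ls c i) = WaitAux 1 \<Longrightarrow> \<omega> (rnd (ls c i)) = \<omega>' (rnd (ls c i))"
  shows "step n t F \<omega> a c = step n t F \<omega>' a c"
proof (cases a)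
  case (Ret i J b)
  show ?thesis
  proof (cases "valid_local n t F i a c \<and> pc (ls c i) = WaitAux 1")
    case True
    then have "\<omega> (rnd (ls c i)) = \<omega>' (rnd (ls c i))" using assms by blast
    with True show ?thesis by (simp add: Ret step_def Let_def)
  next
    case False
    then show ?thesis by (auto simp: Ret step_def Let_def split: phase.splits nat.splits)
  qed
qed (simp_all add: step_def)

text \<open>A step that reads a coin also reveals it, and coins are revealed in order, so while coin
  \<open>r\<close> is hidden only coins below \<open>r\<close> have been read. The adversary thus
  faces equal histories and chooses equal actions.\<close>

lemma run_cong_coin:
  assumes "3 * t < n" "F \<subseteq> {0..<n}" "card F \<le> t" "1 \<le> r" "\<And>q. q < r \<Longrightarrow> \<omega> q = \<omega>' q"
  shows "coins (exec n t F inp \<sigma> \<omega> k) r = None \<Longrightarrow> run n t F inp \<sigma> \<omega> k = run n t F inp \<sigma> \<omega>' k"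
proof (induction k)
  case (Suc k)
  interpret execution n t F inp \<omega> "exec n t F inp \<sigma> \<omega>" "action n t F inp \<sigma> \<omega>"
    using assms(1-3) by (rule execution_exec)
  have "coins (exec n t F inp \<sigma> \<omega> k) r = None"
    using Suc.prems coins_hidden_before le_SucI[OF le_refl] by blast
  note IH = Suc.IH[OF this]
  have "step n t F \<omega> (action n t F inp \<sigma> \<omega> k) (exec n t F inp \<sigma> \<omega> k) =
    step n t F \<omega>' (action n t F inp \<sigma> \<omega> k) (exec n t F inp \<sigma> \<omega> k)"
  proof (rule step_cong_coin)
    fix i
    assume i: "valid_local n t F i (action n t F inp \<sigma> \<omega> k) (exec n t F inp \<sigma> \<omega> k)" "pc (L k i) = WaitAux 1"
    then have "coins (exec n t F inp \<sigma> \<omega> (Suc k)) (rnd (L k i)) \<noteq> None"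
      using coins_Suc[of k "rnd (L k i)"] by auto
    then have "rnd (L k i) < r"
      using coin_hidden_above[OF assms(4) _ Suc.prems] by (meson not_le)
    then show "\<omega> (rnd (L k i)) = \<omega>' (rnd (L k i))"
      by (rule assms(5))
  qed
  then show ?case
    using IH by (simp add: exec_def action_def)
qed simp

definition favoured_value ::
  "nat \<Rightarrow> nat \<Rightarrow> nat set \<Rightarrow> (nat \<Rightarrow> bool) \<Rightarrow> adversary \<Rightarrow> nat \<Rightarrow> (nat \<Rightarrow> coin) \<Rightarrow> bool" where
  "favoured_value n t F inp \<sigma> r \<omega> = execution.favoured n F (exec n t F inp \<sigma> \<omega>) r"

text \<open>The witnessing configuration has coin \<open>r\<close> hidden and so lies in the prefix
  common to both runs; by symmetry one implication suffices.\<close>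

lemma favoured_value_cong:
  assumes "3 * t < n" "F \<subseteq> {0..<n}" "card F \<le> t" "1 \<le> r" "\<And>q. q < r \<Longrightarrow> \<omega> q = \<omega>' q"
  shows "favoured_value n t F inp \<sigma> r \<omega> = favoured_value n t F inp \<sigma> r \<omega>'"
proof -
  have "favoured_value n t F inp \<sigma> r x'" if agree: "favoured_value n t F inp \<sigma> r x" "\<And>q. q < r \<Longrightarrow> x q = x' q" for x x'
  proof -
    interpret X: execution n t F inp x "exec n t F inp \<sigma> x" "action n t F inp \<sigma> x"
      using assms(1-3) by (rule execution_exec)
    interpret X': execution n t F inp x' "exec n t F inp \<sigma> x'" "action n t F inp \<sigma> x'"
      using assms(1-3) by (rule execution_exec)
    obtain k i j where k: "i \<in> correct n F" "coins (exec n t F inp \<sigma> x k) r = None"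
      "(i, j, AUXSET r {Some True}) \<in> net (exec n t F inp \<sigma> x k)"
      using agree(1) unfolding favoured_value_def X.favoured_def by blast
    have "exec n t F inp \<sigma> x k = exec n t F inp \<sigma> x' k"
      using run_cong_coin[OF assms(1-4) agree(2) k(2)] by (simp add: exec_def)
    with k show ?thesis
      unfolding favoured_value_def X'.favoured_def by metis
  qed
  from this[of \<omega> \<omega>'] this[of \<omega>' \<omega>] show ?thesis
    using assms(5) by (metis (full_types))
qed

section \<open>Distribution of a single coin and independence from the past\<close>

lemma UNIV_coin: "UNIV = {CAgree True, CAgree False, CSplit}"
proof -
  have "x \<in> {CAgree True, CAgree False, CSplit}" for x
    by (cases x) auto
  then show ?thesis by blast
qed

lemma pmf_coin_CAgree:
  assumes "2 \<le> d"
  shows "pmf (coin_pmf d) (CAgree b) = 1 / d"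
proof -
  have "pmf (map_pmf CAgree (bernoulli_pmf (1 / 2))) (CAgree b) = pmf (bernoulli_pmf (1 / 2)) b"
    by (rule pmf_map_inj') (simp add: inj_on_def)
  also have "\<dots> = 1 / 2"
    by (cases b) simp_all
  finally show ?thesis
    using assms by (simp add: coin_pmf_def pmf_bind)
qed

lemma emeasure_coin_miss:
  assumes "2 \<le> d"
  shows "emeasure (measure_pmf (coin_pmf d)) (- {CAgree b}) = ennreal (1 - 1 / d)"
proof -
  have "measure (measure_pmf (coin_pmf d)) (- {CAgree b}) = 1 - measure (measure_pmf (coin_pmf d)) {CAgree b}"
    using measure_pmf.prob_compl[of "{CAgree b}" "coin_pmf d"] by (simp add: Compl_eq_Diff_UNIV)
  also have "\<dots> = 1 - 1 / d"
    using pmf_coin_CAgree[OF assms] by (simp add: measure_pmf_single)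
  finally show ?thesis
    by (simp add: measure_pmf.emeasure_eq_measure)
qed

lemma space_coin_space [simp]: "space (coin_space d) = UNIV"
  by (simp add: coin_space_def space_PiM PiE_UNIV_domain)

lemma sets_coordinate: "{\<omega>. \<omega> i \<in> X} \<in> sets (coin_space d)"
proof -
  have "(\<lambda>\<omega>. \<omega> i) \<in> measurable (coin_space d) (measure_pmf (coin_pmf d))"
    unfolding coin_space_def by (rule measurable_component_singleton) simp
  from measurable_sets[OF this, of X] show ?thesis
    by (simp add: vimage_def)
qed

lemma sets_cylinder: "{\<omega>. \<forall>i<m. \<omega> i = g i} \<in> sets (coin_space d)"
proof -
  have "{\<omega> \<in> space (coin_space d). \<forall>i\<in>{..<m}. \<omega> i \<in> {g i}} \<in> sets (coin_space d)"
    by (intro sets.sets_Collect_finite_All) (simp_all only: space_coin_space UNIV_I simp_thms sets_coordinate finite_lessThan)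
  then show ?thesis by (simp add: Ball_def)
qed

lemma emeasure_box:
  assumes "finite J"
  shows "emeasure (coin_space d) {\<omega>. \<forall>i\<in>J. \<omega> i \<in> X i} = (\<Prod>i\<in>J. emeasure (measure_pmf (coin_pmf d)) (X i))"
proof -
  interpret product_prob_space "\<lambda>_::nat. measure_pmf (coin_pmf d)" UNIV
    by unfold_locales
  show ?thesis
    using emeasure_PiM_Collect[OF _ assms, of X]
    by (simp add: coin_space_def space_PiM PiE_UNIV_domain)
qed

text \<open>An event about the coins before round \<open>m\<close> is a finite disjoint union of cylinders.\<close>

lemma
  fixes B :: "(nat \<Rightarrow> coin) set"
  assumes past: "\<And>\<omega> \<omega>'. (\<And>i. i < m \<Longrightarrow> \<omega> i = \<omega>' i) \<Longrightarrow> \<omega> \<in> B \<Longrightarrow> \<omega>' \<in> B"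
  shows sets_past_event: "B \<in> sets (coin_space d)"
    and emeasure_past_event: "emeasure (coin_space d) (B \<inter> {\<omega>. \<omega> m \<in> X}) =
      emeasure (coin_space d) B * emeasure (measure_pmf (coin_pmf d)) X"
proof -
  \<comment> \<open>\<open>G\<close> picks one extensional representative per cylinder; it is finite
    because a coin has only three outcomes.\<close>
  define G where "G = {g \<in> PiE {..<m} (\<lambda>_. UNIV). g \<in> B}"
  define cyl where "cyl g = {\<omega>. \<forall>i<m. \<omega> i = g i}" for g :: "nat \<Rightarrow> coin"
  have fin: "finite G"
    unfolding G_def by (simp add: finite_PiE UNIV_coin)
  have B: "B = (\<Union>g\<in>G. cyl g)"
  proof (intro equalityI subsetI)
    fix \<omega> assume "\<omega> \<in> B"
    then have "restrict \<omega> {..<m} \<in> G"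
      unfolding G_def using past[of \<omega> "restrict \<omega> {..<m}"] by simp
    then show "\<omega> \<in> (\<Union>g\<in>G. cyl g)"
      by (rule UN_I) (simp add: cyl_def)
  next
    fix \<omega> assume "\<omega> \<in> (\<Union>g\<in>G. cyl g)"
    then obtain g where "g \<in> B" "\<And>i. i < m \<Longrightarrow> \<omega> i = g i"
      by (auto simp: G_def cyl_def)
    then show "\<omega> \<in> B"
      using past[of g \<omega>] by simp
  qed
  have cyl: "cyl g \<in> sets (coin_space d)" for g
    unfolding cyl_def by (rule sets_cylinder)
  then show "B \<in> sets (coin_space d)"
    unfolding B using fin by auto
  have disj: "disjoint_family_on cyl G"
    unfolding disjoint_family_on_def
  proof (intro ballI impI)
    fix g h assume gh: "g \<in> G" "h \<in> G" "g \<noteq> h"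
    then obtain i where "i < m" "g i \<noteq> h i"
      unfolding G_def by (metis (no_types, lifting) PiE_ext lessThan_iff mem_Collect_eq)
    then show "cyl g \<inter> cyl h = {}"
      by (auto simp: cyl_def)
  qed
  let ?P = "\<lambda>g. \<Prod>i<m. emeasure (measure_pmf (coin_pmf d)) {g i}"
  have e1: "emeasure (coin_space d) (cyl g) = ?P g" for g
    using emeasure_box[of "{..<m}" d "\<lambda>i. {g i}"] by (simp add: cyl_def lessThan_def)
  have e2: "emeasure (coin_space d) (cyl g \<inter> {\<omega>. \<omega> m \<in> X}) = ?P g * emeasure (measure_pmf (coin_pmf d)) X" for g
  proof -
    \<comment> \<open>Constraining coin \<open>m\<close> in addition adds one factor to the product
      over the coordinates below \<open>m\<close>.\<close>
    have "cyl g \<inter> {\<omega>. \<omega> m \<in> X} = {\<omega>. \<forall>i\<in>{..<Suc m}. \<omega> i \<in> (if i < m then {g i} else X)}"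
      by (auto simp: cyl_def less_Suc_eq)
    then show ?thesis
      using emeasure_box[of "{..<Suc m}" d "\<lambda>i. if i < m then {g i} else X"] by simp
  qed
  have cylX: "cyl g \<inter> {\<omega>. \<omega> m \<in> X} \<in> sets (coin_space d)" for g
    using cyl sets_coordinate by blast
  have "emeasure (coin_space d) (B \<inter> {\<omega>. \<omega> m \<in> X}) = emeasure (coin_space d) (\<Union>g\<in>G. cyl g \<inter> {\<omega>. \<omega> m \<in> X})"
    by (simp add: B)
  also have "\<dots> = (\<Sum>g\<in>G. emeasure (coin_space d) (cyl g \<inter> {\<omega>. \<omega> m \<in> X}))"
    using disj cylX fin by (intro sum_emeasure[symmetric]) (auto simp: disjoint_family_on_def)
  also have "\<dots> = (\<Sum>g\<in>G. emeasure (coin_space d) (cyl g)) * emeasure (measure_pmf (coin_pmf d)) X"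
    by (simp add: e1 e2 sum_distrib_right)
  also have "(\<Sum>g\<in>G. emeasure (coin_space d) (cyl g)) = emeasure (coin_space d) B"
    unfolding B using disj cyl fin by (intro sum_emeasure) auto
  finally show "emeasure (coin_space d) (B \<inter> {\<omega>. \<omega> m \<in> X}) =
      emeasure (coin_space d) B * emeasure (measure_pmf (coin_pmf d)) X" .
qed

section \<open>Waiting time for the first lucky coin\<close>

definition past_determined :: "(nat \<Rightarrow> (nat \<Rightarrow> coin) \<Rightarrow> bool) \<Rightarrow> bool" where
  "past_determined v \<longleftrightarrow> (\<forall>r\<ge>1. \<forall>\<omega> \<omega>'. (\<forall>q<r. \<omega> q = \<omega>' q) \<longrightarrow> v r \<omega> = v r \<omega>')"

lemma past_determinedD:
  "past_determined v \<Longrightarrow> 1 \<le> r \<Longrightarrow> (\<And>q. q < r \<Longrightarrow> \<omega> q = \<omega>' q) \<Longrightarrow> v r \<omega> = v r \<omega>'"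
  unfolding past_determined_def by blast

definition unlucky :: "(nat \<Rightarrow> (nat \<Rightarrow> coin) \<Rightarrow> bool) \<Rightarrow> nat \<Rightarrow> (nat \<Rightarrow> coin) set" where
  "unlucky v m = {\<omega>. \<forall>r\<in>{1..m}. \<omega> r \<noteq> CAgree (v r \<omega>)}"

context
  fixes v :: "nat \<Rightarrow> (nat \<Rightarrow> coin) \<Rightarrow> bool" and d :: real
  assumes v: "past_determined v" and d: "2 \<le> d"
begin

lemma unlucky_past:
  assumes "\<And>i. i < Suc m \<Longrightarrow> \<omega> i = \<omega>' i" "\<omega> \<in> unlucky v m"
  shows "\<omega>' \<in> unlucky v m"
  unfolding unlucky_def
proof (intro CollectI ballI)
  fix r assume r: "r \<in> {1..m}"
  then have "v r \<omega> = v r \<omega>'" "\<omega> r = \<omega>' r"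
    using assms(1) by (auto intro!: past_determinedD[OF v])
  moreover have "\<omega> r \<noteq> CAgree (v r \<omega>)"
    using assms(2) r unfolding unlucky_def by blast
  ultimately show "\<omega>' r \<noteq> CAgree (v r \<omega>')"
    by simp
qed

lemma sets_unlucky: "unlucky v m \<in> sets (coin_space d)"
  using unlucky_past by (rule sets_past_event)

lemma emeasure_unlucky: "emeasure (coin_space d) (unlucky v m) = ennreal (1 - 1 / d) ^ m"
proof (induction m)
  case 0
  interpret prob_space "coin_space d"
    unfolding coin_space_def by (intro prob_space_PiM measure_pmf.prob_space_axioms)
  show ?case
    using emeasure_space_1 by (simp add: unlucky_def)
next
  case (Suc m)
  \<comment> \<open>The target of coin \<open>Suc m\<close> is itself random. Fixing its value
    \<open>b\<close> turns a miss into the constant set \<open>- {CAgree b}\<close>, to which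
    \<open>emeasure_past_event\<close> applies.\<close>
  define B where "B b = unlucky v m \<inter> {\<omega>. v (Suc m) \<omega> = b}" for b
  have past: "\<omega>' \<in> B b" if "\<And>i. i < Suc m \<Longrightarrow> \<omega> i = \<omega>' i" "\<omega> \<in> B b" for \<omega> \<omega>' b
    using that unlucky_past[of m \<omega> \<omega>'] past_determinedD[OF v, of "Suc m" \<omega> \<omega>'] unfolding B_def by auto
  have sets_B: "B b \<in> sets (coin_space d)" for b
    using past by (rule sets_past_event)
  let ?X = "\<lambda>b. B b \<inter> {\<omega>. \<omega> (Suc m) \<in> - {CAgree b}}"
  have sets_X: "?X b \<in> sets (coin_space d)" for b
    using sets_B sets_coordinate by blast
  have miss: "emeasure (coin_space d) (?X b) = emeasure (coin_space d) (B b) * ennreal (1 - 1 / d)" for b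
    unfolding emeasure_coin_miss[OF d, of b, symmetric] using past by (rule emeasure_past_event)
  have "unlucky v (Suc m) = ?X True \<union> ?X False"
  proof -
    have "{1..Suc m} = insert (Suc m) {1..m}" by auto
    then have *: "\<omega> \<in> unlucky v (Suc m) \<longleftrightarrow> \<omega> \<in> unlucky v m \<and> \<omega> (Suc m) \<noteq> CAgree (v (Suc m) \<omega>)" for \<omega>
      unfolding unlucky_def mem_Collect_eq by (simp only: ball_insert conj_commute)
    show ?thesis
    proof (rule set_eqI)
      fix \<omega>
      show "\<omega> \<in> unlucky v (Suc m) \<longleftrightarrow> \<omega> \<in> ?X True \<union> ?X False"
        by (cases "v (Suc m) \<omega>") (simp_all add: * B_def)
    qed
  qed
  moreover have "?X True \<inter> ?X False = {}"
    unfolding B_def by blast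
  ultimately have "emeasure (coin_space d) (unlucky v (Suc m)) =
    emeasure (coin_space d) (?X True) + emeasure (coin_space d) (?X False)"
    using plus_emeasure[OF sets_X sets_X] by metis
  also have "\<dots> = (emeasure (coin_space d) (B True) + emeasure (coin_space d) (B False)) * ennreal (1 - 1 / d)"
    by (simp only: miss distrib_right)
  also have "emeasure (coin_space d) (B True) + emeasure (coin_space d) (B False) = emeasure (coin_space d) (B True \<union> B False)"
    using sets_B sets_B by (rule plus_emeasure) (auto simp: B_def)
  also have "B True \<union> B False = unlucky v m"
    by (auto simp: B_def)
  finally show ?case
    by (simp add: Suc.IH mult.commute)
qed

text \<open>Tail-sum formula: \<open>unlucky v m\<close> is the event that the first hit comes after
  round \<open>m\<close>, so the series integrates to the mean \<open>d\<close> of a geometric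
  variable. The extra 1 stands for the round following the hit.\<close>

lemma nn_integral_unlucky:
  "(\<integral>\<^sup>+ \<omega>. (1 + (\<Sum>m. indicator (unlucky v m) \<omega>)) \<partial>coin_space d) = ennreal (d + 1)"
proof -
  interpret prob_space "coin_space d"
    unfolding coin_space_def by (intro prob_space_PiM measure_pmf.prob_space_axioms)
  have ind [measurable]: "indicator (unlucky v m) \<in> borel_measurable (coin_space d)" for m
    using sets_unlucky by simp
  have q: "0 \<le> 1 - 1 / d" "1 - 1 / d < 1"
    using d by (simp_all add: field_simps)
  have "(\<integral>\<^sup>+ \<omega>. (1 + (\<Sum>m. indicator (unlucky v m) \<omega>)) \<partial>coin_space d) =
    1 + (\<integral>\<^sup>+ \<omega>. (\<Sum>m. indicator (unlucky v m) \<omega>) \<partial>coin_space d)"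
    using emeasure_space_1 by (subst nn_integral_add) auto
  also have "(\<integral>\<^sup>+ \<omega>. (\<Sum>m. indicator (unlucky v m) \<omega>) \<partial>coin_space d) =
    (\<Sum>m. \<integral>\<^sup>+ \<omega>. indicator (unlucky v m) \<omega> \<partial>coin_space d)"
    by (intro nn_integral_suminf) auto
  also have "\<dots> = (\<Sum>m. ennreal ((1 - 1 / d) ^ m))"
    by (simp only: nn_integral_indicator[OF sets_unlucky] emeasure_unlucky ennreal_power[OF q(1)])
  also have "\<dots> = ennreal d"
  proof -
    have "(\<lambda>m. (1 - 1 / d) ^ m) sums (1 / (1 - (1 - 1 / d)))"
      using q by (intro geometric_sums) simp
    then have "(\<lambda>m. (1 - 1 / d) ^ m) sums d"
      using d by simp
    then show ?thesis
      using q by (subst suminf_ennreal_eq[of _ d]) auto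
  qed
  also have "1 + ennreal d = ennreal (d + 1)"
    using d by (simp add: ennreal_plus add.commute)
  finally show ?thesis .
qed

text \<open>The events decrease in \<open>m\<close>, so the indicators with index \<open>0\<close>
  to \<open>m\<close> are all 1.\<close>

lemma le_suminf_unlucky:
  assumes "\<omega> \<in> unlucky v m"
  shows "of_nat (Suc m) \<le> (\<Sum>k. indicator (unlucky v k) \<omega> :: ennreal)"
proof -
  have "(\<Sum>k<Suc m. indicator (unlucky v k) \<omega> :: ennreal) = (\<Sum>k<Suc m. 1)"
    using assms by (intro sum.cong) (auto simp: unlucky_def)
  then have "of_nat (Suc m) = (\<Sum>k<Suc m. indicator (unlucky v k) \<omega> :: ennreal)"
    by simp
  also have "\<dots> \<le> (\<Sum>k. indicator (unlucky v k) \<omega>)"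
    by (rule sum_le_suminf) auto
  finally show ?thesis .
qed

lemma suminf_unlucky_top:
  assumes "\<And>r. 1 \<le> r \<Longrightarrow> \<omega> r \<noteq> CAgree (v r \<omega>)"
  shows "(\<Sum>k. indicator (unlucky v k) \<omega> :: ennreal) = \<infinity>"
proof (rule ccontr)
  assume "\<not> ?thesis"
  then obtain m where "(\<Sum>k. indicator (unlucky v k) \<omega> :: ennreal) < of_nat m"
    using ennreal_Ex_less_of_nat by (auto simp: less_top)
  moreover have "of_nat (Suc m) \<le> (\<Sum>k. indicator (unlucky v k) \<omega> :: ennreal)"
    using assms by (intro le_suminf_unlucky) (simp add: unlucky_def)
  ultimately have "(of_nat (Suc m) :: ennreal) < of_nat m"
    by (rule le_less_trans[rotated])
  then show False by simp
qed

text \<open>Without a hit the series is infinite, which a finite integral permits only on a null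
  set.\<close>

lemma AE_lucky: "AE \<omega> in coin_space d. \<exists>r\<ge>1. \<omega> r = CAgree (v r \<omega>)"
proof -
  have ind [measurable]: "indicator (unlucky v m) \<in> borel_measurable (coin_space d)" for m
    using sets_unlucky by simp
  have "AE \<omega> in coin_space d. 1 + (\<Sum>m. indicator (unlucky v m) \<omega>) \<noteq> (\<infinity>::ennreal)"
    using nn_integral_unlucky by (intro nn_integral_noteq_infinite) auto
  then show ?thesis
  proof eventually_elim
    case (elim \<omega>)
    show ?case
    proof (rule ccontr)
      assume "\<not> ?case"
      then have "(\<Sum>k. indicator (unlucky v k) \<omega> :: ennreal) = \<infinity>"
        by (intro suminf_unlucky_top) blast
      with elim show False by simp
    qed
  qed
qed

end

theorem theorem1:
  fixes n t :: nat and F :: "nat set" and d :: real and inp :: "nat \<Rightarrow> bool"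
    and \<sigma> :: adversary
  assumes "3 * t < n" and "F \<subseteq> {0..<n}" and "card F \<le> t" and "2 \<le> d"
    and "admissible n t F inp \<sigma>"
  shows
    "(\<forall>\<omega> k k' i j a b ra rb. i \<in> correct n F \<and> j \<in> correct n F \<and>
        dec (ls (exec n t F inp \<sigma> \<omega> k) i) = Some (a, ra) \<and>
        dec (ls (exec n t F inp \<sigma> \<omega> k') j) = Some (b, rb) \<longrightarrow> a = b)
   \<and> (\<forall>\<omega> k i v r. i \<in> correct n F \<and> dec (ls (exec n t F inp \<sigma> \<omega> k) i) = Some (v, r) \<longrightarrow>
        (\<exists>j\<in>correct n F. inp j = v))
   \<and> (AE \<omega> in coin_space d. \<forall>i\<in>correct n F. \<exists>k. dec (ls (exec n t F inp \<sigma> \<omega> k) i) \<noteq> None)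
   \<and> (\<integral>\<^sup>+ \<omega>. rounds n t F inp \<sigma> \<omega> \<partial>coin_space d) \<le> ennreal (d + 1)"
proof (intro conjI allI impI)
  fix \<omega> k k' i j a b ra rb
  interpret execution n t F inp \<omega> "exec n t F inp \<sigma> \<omega>" "action n t F inp \<sigma> \<omega>"
    using assms(1-3) by (rule execution_exec)
  assume "i \<in> correct n F \<and> j \<in> correct n F \<and>
        dec (ls (exec n t F inp \<sigma> \<omega> k) i) = Some (a, ra) \<and>
        dec (ls (exec n t F inp \<sigma> \<omega> k') j) = Some (b, rb)"
  then show "a = b"
    using agreement by blast
next
  fix \<omega> k i v r
  interpret execution n t F inp \<omega> "exec n t F inp \<sigma> \<omega>" "action n t F inp \<sigma> \<omega>"
    using assms(1-3) by (rule execution_exec)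
  assume "i \<in> correct n F \<and> dec (ls (exec n t F inp \<sigma> \<omega> k) i) = Some (v, r)"
  then show "\<exists>j\<in>correct n F. inp j = v"
    using validity(2) by blast
next
  let ?v = "favoured_value n t F inp \<sigma>"
  have past: "past_determined ?v"
    unfolding past_determined_def using favoured_value_cong[OF assms(1-3)] by metis
  have lucky: "\<exists>k. \<forall>i\<in>correct n F. \<exists>v r'. dec (ls (exec n t F inp \<sigma> \<omega> k) i) = Some (v, r') \<and> r' \<le> Suc r"
    if r: "1 \<le> r" "\<omega> r = CAgree (?v r \<omega>)" for \<omega> r
  proof -
    interpret fair_execution n t F inp \<omega> "exec n t F inp \<sigma> \<omega>" "action n t F inp \<sigma> \<omega>"
      using assms(1-3,5) by (rule fair_execution_exec)
    show ?thesis
      using lucky_coin_decides[OF r(1)] r(2) by (simp add: favoured_value_def)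
  qed
  show "AE \<omega> in coin_space d. \<forall>i\<in>correct n F. \<exists>k. dec (ls (exec n t F inp \<sigma> \<omega> k) i) \<noteq> None"
    using AE_lucky[OF past assms(4)]
  proof eventually_elim
    case (elim \<omega>)
    then obtain r where "1 \<le> r" "\<omega> r = CAgree (?v r \<omega>)" by blast
    from lucky[OF this] show ?case by (metis option.distinct(1))
  qed
  \<comment> \<open>The bound holds at every \<open>\<omega>\<close>, being trivial where the coin
    never hits, so the integrals are compared pointwise without a measurability argument for
    \<open>rounds\<close>.\<close>
  have "rounds n t F inp \<sigma> \<omega> \<le> 1 + (\<Sum>m. indicator (unlucky ?v m) \<omega>)" for \<omega>
  proof (cases "\<exists>r\<ge>1. \<omega> r = CAgree (?v r \<omega>)")
    case False
    then show ?thesis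
      using suminf_unlucky_top[OF past assms(4), of \<omega>] by simp
  next
    case True
    define r where "r = (LEAST r. 1 \<le> r \<and> \<omega> r = CAgree (?v r \<omega>))"
    have r: "1 \<le> r" "\<omega> r = CAgree (?v r \<omega>)"
      using LeastI_ex[of "\<lambda>r. 1 \<le> r \<and> \<omega> r = CAgree (?v r \<omega>)"] True unfolding r_def by blast+
    have "rounds n t F inp \<sigma> \<omega> \<le> of_nat (Suc r)"
      unfolding rounds_def using lucky[OF r] by (intro Inf_lower) blast
    \<comment> \<open>By minimality rounds \<open>1\<close> to \<open>r - 1\<close> missed. The
      series is then at least \<open>r\<close>, and the leading 1 pays for round
      \<open>Suc r\<close>.\<close>
    moreover have "\<omega> \<in> unlucky ?v (r - 1)"
      unfolding unlucky_def
    proof (intro CollectI ballI)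
      fix q assume "q \<in> {1..r - 1}"
      with r(1) have "q < r" "1 \<le> q" by auto
      then show "\<omega> q \<noteq> CAgree (?v q \<omega>)"
        using not_less_Least[of q "\<lambda>r. 1 \<le> r \<and> \<omega> r = CAgree (?v r \<omega>)"] unfolding r_def by blast
    qed
    then have "of_nat (Suc (r - 1)) \<le> (\<Sum>m. indicator (unlucky ?v m) \<omega> :: ennreal)"
      by (rule le_suminf_unlucky[OF past assms(4)])
    then have "1 + of_nat r \<le> 1 + (\<Sum>m. indicator (unlucky ?v m) \<omega> :: ennreal)"
      using r(1) by (intro add_left_mono) simp
    ultimately show ?thesis
      by (metis add.commute of_nat_Suc order_trans)
  qed
  then have "(\<integral>\<^sup>+ \<omega>. rounds n t F inp \<sigma> \<omega> \<partial>coin_space d) \<le>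
    (\<integral>\<^sup>+ \<omega>. (1 + (\<Sum>m. indicator (unlucky ?v m) \<omega>)) \<partial>coin_space d)"
    by (intro nn_integral_mono)
  then show "(\<integral>\<^sup>+ \<omega>. rounds n t F inp \<sigma> \<omega> \<partial>coin_space d) \<le> ennreal (d + 1)"
    using nn_integral_unlucky[OF past assms(4)] by simp
qed

end
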